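(* Let $T$ be $\mathrm{DLO}$ or $\mathrm{DOAG}$ and $\boldsymbol{M}\models T$. A definable set $D\subseteq\boldsymbol{M}^{(x;y)}$ is stable with respect to $(x;y)$ if and only if $D$ is a finite union of special stable sets. Equivalently, an $L(\boldsymbol{M})$-formula $\varphi(x;y)$ is stable if and only if it is $T$-equivalent to a finite disjunction of formulas of the form $\psi(x)\wedge\theta(y)\wedge\chi(x,y)$ with $\psi,\theta$ arbitrary $L(\boldsymbol{M})$-formulas and $\chi$ a Boolean combination of atomic $L(\boldsymbol{M})$-formulas not containing $<$.
   Context: $\mathrm{DLO}=\mathrm{Th}(\mathbb{R},<)$ in $L=\{<\}$, $\mathrm{DOAG}=\mathrm{Th}(\mathbb{R},+,<)$ in the ordered group language; "definable" means definable with parameters. A definable $D\subseteq\boldsymbol{M}^{(x;y)}$ is unstable with respect to $(x;y)$ if there are $a_i\in\boldsymbol{M}^x$, $b_j\in\boldsymbol{M}^y$ ($i,j<\omega$) with $(a_i,b_j)\in D$ iff $i\le j$; otherwise stable. A set is equationally definable if it is defined by a Boolean combination of atomic formulas with parameters not involving $<$. $D$ is special stable if $D=Z\cap(X\times Y)$ for some definable $X\subseteq\boldsymbol{M}^x$, $Y\subseteq\boldsymbol{M}^y$ and equationally definable $Z\subseteq\boldsymbol{M}^{(x;y)}$. *)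

theory Defs
  imports Complex_Main
begin

datatype 'a trm = Var nat | Par 'a | Zero | Add "'a trm" "'a trm" | Neg "'a trm"

datatype 'a fm = FF | Eq "'a trm" "'a trm" | Less "'a trm" "'a trm"
  | FNot "'a fm" | FConj "'a fm" "'a fm" | FEx nat "'a fm"

text \<open>A structure for the (ordered group) language; for DLO only s_less is used.\<close>
record 'a struc =
  s_less :: "'a \<Rightarrow> 'a \<Rightarrow> bool"
  s_add :: "'a \<Rightarrow> 'a \<Rightarrow> 'a"
  s_neg :: "'a \<Rightarrow> 'a"
  s_zero :: 'a

fun tval :: "'a struc \<Rightarrow> (nat \<Rightarrow> 'a) \<Rightarrow> 'a trm \<Rightarrow> 'a" where
  "tval M e (Var i) = e i"
| "tval M e (Par a) = a"
| "tval M e Zero = s_zero M"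
| "tval M e (Add s t) = s_add M (tval M e s) (tval M e t)"
| "tval M e (Neg t) = s_neg M (tval M e t)"

fun holds :: "'a struc \<Rightarrow> (nat \<Rightarrow> 'a) \<Rightarrow> 'a fm \<Rightarrow> bool" where
  "holds M e FF = False"
| "holds M e (Eq s t) = (tval M e s = tval M e t)"
| "holds M e (Less s t) = s_less M (tval M e s) (tval M e t)"
| "holds M e (FNot \<phi>) = (\<not> holds M e \<phi>)"
| "holds M e (FConj \<phi> \<psi>) = (holds M e \<phi> \<and> holds M e \<psi>)"
| "holds M e (FEx k \<phi>) = (\<exists>a. holds M (e(k := a)) \<phi>)"

fun fvt :: "'a trm \<Rightarrow> nat set" where
  "fvt (Var i) = {i}"
| "fvt (Par a) = {}"
| "fvt Zero = {}"
| "fvt (Add s t) = fvt s \<union> fvt t"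
| "fvt (Neg t) = fvt t"

fun fv :: "'a fm \<Rightarrow> nat set" where
  "fv FF = {}"
| "fv (Eq s t) = fvt s \<union> fvt t"
| "fv (Less s t) = fvt s \<union> fvt t"
| "fv (FNot \<phi>) = fv \<phi>"
| "fv (FConj \<phi> \<psi>) = fv \<phi> \<union> fv \<psi>"
| "fv (FEx k \<phi>) = fv \<phi> - {k}"

fun order_trm :: "'a trm \<Rightarrow> bool" where
  "order_trm (Var i) = True"
| "order_trm (Par a) = True"
| "order_trm _ = False"

fun order_fm :: "'a fm \<Rightarrow> bool" where
  "order_fm FF = True"
| "order_fm (Eq s t) = (order_trm s \<and> order_trm t)"
| "order_fm (Less s t) = (order_trm s \<and> order_trm t)"
| "order_fm (FNot \<phi>) = order_fm \<phi>"
| "order_fm (FConj \<phi> \<psi>) = (order_fm \<phi> \<and> order_fm \<psi>)"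
| "order_fm (FEx k \<phi>) = order_fm \<phi>"

text \<open>oag = False: language L = {<} (theory DLO); oag = True: ordered group language
  {+,-,0,<} (theory DOAG).\<close>
definition in_lang :: "bool \<Rightarrow> 'a fm \<Rightarrow> bool" where
  "in_lang oag \<phi> \<longleftrightarrow> oag \<or> order_fm \<phi>"

definition real_struc :: "real struc" where
  "real_struc = \<lparr>s_less = (<), s_add = (+), s_neg = uminus, s_zero = 0\<rparr>"

text \<open>M is a model of T = Th(R,<) (oag = False) or T = Th(R,+,<) (oag = True):
  every parameter-free sentence of the language has the same truth value in M and in R.\<close>
definition models_T :: "bool \<Rightarrow> 'a struc \<Rightarrow> bool" where
  "models_T oag M \<longleftrightarrow>
     (\<forall>(\<phi>::'a fm) e e'. in_lang oag \<phi> \<and> set_fm \<phi> = {} \<and> fv \<phi> = {} \<longrightarrow>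
        (holds M e \<phi> \<longleftrightarrow> holds real_struc e' (map_fm (\<lambda>_. 0) \<phi>)))"

definition definable :: "bool \<Rightarrow> 'a struc \<Rightarrow> nat \<Rightarrow> 'a list set \<Rightarrow> bool" where
  "definable oag M n X \<longleftrightarrow>
     (\<exists>\<phi>. in_lang oag \<phi> \<and> fv \<phi> \<subseteq> {..<n} \<and>
          X = {as. length as = n \<and> holds M (nth as) \<phi>})"

definition definable2 :: "bool \<Rightarrow> 'a struc \<Rightarrow> nat \<Rightarrow> nat \<Rightarrow> ('a list \<times> 'a list) set \<Rightarrow> bool" where
  "definable2 oag M m n D \<longleftrightarrow>
     D \<subseteq> {(a, b). length a = m \<and> length b = n} \<and>
     definable oag M (m + n) ((\<lambda>(a, b). a @ b) ` D)"

fun equational_fm :: "'a fm \<Rightarrow> bool" where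
  "equational_fm FF = True"
| "equational_fm (Eq s t) = True"
| "equational_fm (Less s t) = False"
| "equational_fm (FNot \<phi>) = equational_fm \<phi>"
| "equational_fm (FConj \<phi> \<psi>) = (equational_fm \<phi> \<and> equational_fm \<psi>)"
| "equational_fm (FEx k \<phi>) = False"

definition eq_definable2 :: "bool \<Rightarrow> 'a struc \<Rightarrow> nat \<Rightarrow> nat \<Rightarrow> ('a list \<times> 'a list) set \<Rightarrow> bool" where
  "eq_definable2 oag M m n Z \<longleftrightarrow>
     (\<exists>\<phi>. in_lang oag \<phi> \<and> equational_fm \<phi> \<and> fv \<phi> \<subseteq> {..<m + n} \<and>
          Z = {(a, b). length a = m \<and> length b = n \<and> holds M (nth (a @ b)) \<phi>})"

definition unstable :: "nat \<Rightarrow> nat \<Rightarrow> ('a list \<times> 'a list) set \<Rightarrow> bool" where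
  "unstable m n D \<longleftrightarrow>
     (\<exists>a b :: nat \<Rightarrow> 'a list. (\<forall>i. length (a i) = m) \<and> (\<forall>j. length (b j) = n) \<and>
        (\<forall>i j. (a i, b j) \<in> D \<longleftrightarrow> i \<le> j))"

definition stable_xy :: "nat \<Rightarrow> nat \<Rightarrow> ('a list \<times> 'a list) set \<Rightarrow> bool" where
  "stable_xy m n D \<longleftrightarrow> \<not> unstable m n D"

definition special_stable :: "bool \<Rightarrow> 'a struc \<Rightarrow> nat \<Rightarrow> nat \<Rightarrow> ('a list \<times> 'a list) set \<Rightarrow> bool" where
  "special_stable oag M m n D \<longleftrightarrow>
     (\<exists>X Y Z. definable oag M m X \<and> definable oag M n Y \<and> eq_definable2 oag M m n Z \<and>
        D = Z \<inter> (X \<times> Y))"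

end

theory Submission
  imports Defs "HOL-Library.Nat_Bijection" "HOL-Library.Ramsey"
begin

text \<open>
  Over the reals, quantifier elimination reduces \<open>D\<close> to the walls \<open>p(x) = q(y)\<close> and to conditions on
  \<open>x\<close> and on \<open>y\<close> alone. Fix the set \<open>E\<close> of walls that \<open>(x, y)\<close> lies on and the common values of \<open>p(x)\<close> and
  \<open>q(y)\<close> for \<open>(p, q) \<in> E\<close>; this leaves a convex region \<open>X \<times> Y\<close>. A wall for which \<open>p\<close> is constant on \<open>X\<close> or
  \<open>q\<close> is constant on \<open>Y\<close> only imposes a condition on \<open>y\<close> or on \<open>x\<close>. If \<open>D\<close> changes across one of the other
  walls, then near a generic point of that wall \<open>D\<close> or its complement is \<open>p(x) < q(y)\<close>, which yields
  a half graph; otherwise \<open>D\<close> is constant off the walls. This dichotomy is first-order, hence it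
  passes from the reals to every model, saturated or not. Conversely, Ramsey's theorem shows that
  an infinite half graph cannot be cut out by equations, since for each equation \<open>p(x) = q(y)\<close> three
  corners of a rectangle in its solution set force the fourth.
\<close>

section \<open>Substitution and parameter-free formulas\<close>

text \<open>The common values range over an infinite set although a finite union is wanted, so they
  are never named. Lying on exactly the walls of \<open>E\<close> is an equational condition on
  \<open>(x, y)\<close>, and the verdict of \<open>D\<close> on the region is asked of
  \<open>x\<close> alone: does some pair \<open>(x', y')\<close> with the same common values and on
  the same sides of the half-constant walls belong to \<open>D\<close>? Instability speaks of
  infinite sequences and is not first-order. What is transferred is therefore a local picture from
  which density alone builds a half graph in any model. Parameters become variables, so that the
  walls and the transferred sentence depend on the shape of the formula only and hold for all
  parameter values at once. Division, limits and quantifier elimination are then needed over the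
  reals only.\<close>

fun subt :: "(nat \<Rightarrow> 'a trm) \<Rightarrow> 'a trm \<Rightarrow> 'a trm" where
  "subt \<sigma> (Var i) = \<sigma> i"
| "subt \<sigma> (Par a) = Par a"
| "subt \<sigma> Zero = Zero"
| "subt \<sigma> (Add s t) = Add (subt \<sigma> s) (subt \<sigma> t)"
| "subt \<sigma> (Neg t) = Neg (subt \<sigma> t)"

text \<open>The new bound variable occurs in no \<open>\<sigma> v\<close> with \<open>v\<close> in
  \<open>V\<close>, so \<open>sub\<close> avoids capture. Such an index exists because
  \<open>V\<close> is finite where this is applied.\<close>

definition fresh :: "(nat \<Rightarrow> 'a trm) \<Rightarrow> nat set \<Rightarrow> nat" where
  "fresh \<sigma> V = (SOME j. \<forall>v\<in>V. j \<notin> fvt (\<sigma> v))"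

fun sub :: "(nat \<Rightarrow> 'a trm) \<Rightarrow> 'a fm \<Rightarrow> 'a fm" where
  "sub \<sigma> FF = FF"
| "sub \<sigma> (Eq s t) = Eq (subt \<sigma> s) (subt \<sigma> t)"
| "sub \<sigma> (Less s t) = Less (subt \<sigma> s) (subt \<sigma> t)"
| "sub \<sigma> (FNot \<phi>) = FNot (sub \<sigma> \<phi>)"
| "sub \<sigma> (FConj \<phi> \<psi>) = FConj (sub \<sigma> \<phi>) (sub \<sigma> \<psi>)"
| "sub \<sigma> (FEx k \<phi>) = FEx (fresh \<sigma> (fv \<phi>)) (sub (\<sigma>(k := Var (fresh \<sigma> (fv \<phi>)))) \<phi>)"

lemma finite_fvt [simp]: "finite (fvt t)"
  by (induction t) auto

lemma finite_fv [simp]: "finite (fv \<phi>)"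
  by (induction \<phi>) auto

lemma fvt_map_trm [simp]: "fvt (map_trm f t) = fvt t"
  by (induction t) auto

lemma fv_map_fm [simp]: "fv (map_fm f \<phi>) = fv \<phi>"
  by (induction \<phi>) auto

lemma order_trm_map [simp]: "order_trm (map_trm f t) = order_trm t"
  by (cases t) auto

lemma order_fm_map [simp]: "order_fm (map_fm f \<phi>) = order_fm \<phi>"
  by (induction \<phi>) auto

lemma tval_cong: "(\<And>v. v \<in> fvt t \<Longrightarrow> e v = e' v) \<Longrightarrow> tval M e t = tval M e' t"
  by (induction t) auto

lemma holds_cong:
  assumes "\<And>v. v \<in> fv \<phi> \<Longrightarrow> e v = e' v"
  shows "holds M e \<phi> = holds M e' \<phi>"
proof -
  have "\<forall>v\<in>fv \<phi>. e v = e' v \<Longrightarrow> holds M e \<phi> = holds M e' \<phi>"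
  proof (induction \<phi> arbitrary: e e')
    case (Eq s t)
    then show ?case using tval_cong[of s e e' M] tval_cong[of t e e' M] by simp
  next
    case (Less s t)
    then show ?case using tval_cong[of s e e' M] tval_cong[of t e e' M] by simp
  next
    case (FNot \<phi>)
    show ?case using FNot.IH[of e e'] FNot.prems by simp
  next
    case (FConj \<phi> \<psi>)
    show ?case using FConj.IH(1)[of e e'] FConj.IH(2)[of e e'] FConj.prems by simp
  next
    case (FEx k \<phi>)
    have "holds M (e(k := a)) \<phi> = holds M (e'(k := a)) \<phi>" for a
      by (rule FEx.IH) (use FEx.prems in auto)
    then show ?case by simp
  qed simp
  then show ?thesis using assms by blast
qed

lemma fresh_notin:
  assumes "finite V" "v \<in> V"
  shows "fresh \<sigma> V \<notin> fvt (\<sigma> v)"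
proof -
  have "finite (\<Union>v\<in>V. fvt (\<sigma> v))" using assms by auto
  then obtain j where "j \<notin> (\<Union>v\<in>V. fvt (\<sigma> v))"
    using ex_new_if_finite infinite_UNIV_nat by blast
  then have "\<forall>v\<in>V. j \<notin> fvt (\<sigma> v)" by auto
  then show ?thesis
    unfolding fresh_def using assms(2) someI[of "\<lambda>j. \<forall>v\<in>V. j \<notin> fvt (\<sigma> v)"] by blast
qed

lemma tval_subt:
  "tval S e (map_trm f (subt \<sigma> t)) = tval S (\<lambda>v. tval S e (map_trm f (\<sigma> v))) (map_trm f t)"
  by (induction t) auto

text \<open>The map \<open>f\<close> changes the parameter type, so that the same fact serves
  formulas over \<open>unit\<close> evaluated in any structure. In the quantifier case
  \<open>j\<close> occurs in no \<open>\<sigma> v\<close> for \<open>v\<close> free in the body,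
  hence a new value for \<open>j\<close> does not disturb these terms.\<close>

lemma holds_map_sub:
  "holds S e (map_fm f (sub \<sigma> \<phi>)) = holds S (\<lambda>v. tval S e (map_trm f (\<sigma> v))) (map_fm f \<phi>)"
proof (induction \<phi> arbitrary: \<sigma> e)
  case (FEx k \<phi>)
  define j where "j = fresh \<sigma> (fv \<phi>)"
  have "holds S (\<lambda>v. tval S (e(j := a)) (map_trm f ((\<sigma>(k := Var j)) v))) (map_fm f \<phi>)
      = holds S ((\<lambda>v. tval S e (map_trm f (\<sigma> v)))(k := a)) (map_fm f \<phi>)" for a
  proof (rule holds_cong)
    fix v assume v: "v \<in> fv (map_fm f \<phi>)"
    have "j \<notin> fvt (\<sigma> v)" unfolding j_def by (rule fresh_notin) (use v in simp_all)
    then show "tval S (e(j := a)) (map_trm f ((\<sigma>(k := Var j)) v))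
        = ((\<lambda>v. tval S e (map_trm f (\<sigma> v)))(k := a)) v"
      by (auto intro!: tval_cong)
  qed
  then show ?case unfolding sub.simps fm.map holds.simps FEx.IH j_def[symmetric] by simp
qed (auto simp: tval_subt)

lemma holds_sub: "holds S e (sub \<sigma> \<phi>) = holds S (\<lambda>v. tval S e (\<sigma> v)) \<phi>"
  using holds_map_sub[of S e id] by (simp add: fm.map_id0 trm.map_id0)

lemma order_trm_subt: "order_trm t \<Longrightarrow> (\<And>v. order_trm (\<sigma> v)) \<Longrightarrow> order_trm (subt \<sigma> t)"
  by (cases t) auto

lemma order_fm_sub: "order_fm \<phi> \<Longrightarrow> (\<And>v. order_trm (\<sigma> v)) \<Longrightarrow> order_fm (sub \<sigma> \<phi>)"
  by (induction \<phi> arbitrary: \<sigma>) (auto simp: order_trm_subt)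

lemma fvt_subt: "fvt (subt \<sigma> t) = (\<Union>v\<in>fvt t. fvt (\<sigma> v))"
  by (induction t) auto

lemma fv_sub: "fv (sub \<sigma> \<phi>) \<subseteq> (\<Union>v\<in>fv \<phi>. fvt (\<sigma> v))"
proof (induction \<phi> arbitrary: \<sigma>)
  case (FNot \<phi>)
  then show ?case by simp
next
  case (FConj \<phi> \<psi>)
  show ?case using FConj.IH(1)[of \<sigma>] FConj.IH(2)[of \<sigma>] unfolding sub.simps fv.simps by blast
next
  case (FEx k \<phi>)
  define j where "j = fresh \<sigma> (fv \<phi>)"
  have "(\<Union>v\<in>fv \<phi>. fvt ((\<sigma>(k := Var j)) v)) - {j} \<subseteq> (\<Union>v\<in>fv \<phi> - {k}. fvt (\<sigma> v))"
    by (auto split: if_splits)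
  with FEx.IH[of "\<sigma>(k := Var j)"] show ?case unfolding sub.simps fv.simps j_def[symmetric] by blast
qed (simp_all add: fvt_subt)

lemma set_subt: "set_trm (subt \<sigma> t) \<subseteq> set_trm t \<union> (\<Union>v. set_trm (\<sigma> v))"
  by (induction t) auto

lemma set_sub: "set_fm (sub \<sigma> \<phi>) \<subseteq> set_fm \<phi> \<union> (\<Union>v. set_trm (\<sigma> v))"
proof (induction \<phi> arbitrary: \<sigma>)
  case (Eq s t)
  then show ?case using set_subt[of \<sigma> s] set_subt[of \<sigma> t] by auto
next
  case (Less s t)
  then show ?case using set_subt[of \<sigma> s] set_subt[of \<sigma> t] by auto
next
  case (FConj \<phi> \<psi>)
  then show ?case using FConj.IH(1)[of \<sigma>] FConj.IH(2)[of \<sigma>] by auto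
next
  case (FEx k \<phi>)
  define j where "j = fresh \<sigma> (fv \<phi>)"
  have "(\<Union>v. set_trm ((\<sigma>(k := Var j)) v)) \<subseteq> (\<Union>v. set_trm (\<sigma> v))"
    by (auto split: if_splits)
  with FEx.IH[of "\<sigma>(k := Var j)"] show ?case unfolding sub.simps fm.set j_def[symmetric] by blast
qed simp_all

text \<open>Parameter-free syntax is represented over the parameter type \<^typ>\<open>unit\<close>, so that one formula can be
  evaluated in structures over different types.\<close>

definition tv :: "'b struc \<Rightarrow> (nat \<Rightarrow> 'b) \<Rightarrow> unit trm \<Rightarrow> 'b" where
  "tv S e t = tval S e (map_trm (\<lambda>_. s_zero S) t)"

definition sat :: "'b struc \<Rightarrow> (nat \<Rightarrow> 'b) \<Rightarrow> unit fm \<Rightarrow> bool" where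
  "sat S e \<phi> = holds S e (map_fm (\<lambda>_. s_zero S) \<phi>)"

definition pure_trm :: "bool \<Rightarrow> unit trm \<Rightarrow> bool" where
  "pure_trm oag t \<longleftrightarrow> set_trm t = {} \<and> (oag \<or> order_trm t)"

definition pure_fm :: "bool \<Rightarrow> unit fm \<Rightarrow> bool" where
  "pure_fm oag \<phi> \<longleftrightarrow> set_fm \<phi> = {} \<and> in_lang oag \<phi>"

lemma tv_simps [simp]:
  "tv S e (Var i) = e i"
  "tv S e Zero = s_zero S"
  "tv S e (Add s t) = s_add S (tv S e s) (tv S e t)"
  "tv S e (Neg t) = s_neg S (tv S e t)"
  by (simp_all add: tv_def)

lemma sat_simps [simp]:
  "sat S e FF = False"
  "sat S e (Eq s t) = (tv S e s = tv S e t)"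
  "sat S e (Less s t) = s_less S (tv S e s) (tv S e t)"
  "sat S e (FNot \<phi>) = (\<not> sat S e \<phi>)"
  "sat S e (FConj \<phi> \<psi>) = (sat S e \<phi> \<and> sat S e \<psi>)"
  "sat S e (FEx k \<phi>) = (\<exists>a. sat S (e(k := a)) \<phi>)"
  by (simp_all add: sat_def tv_def)

lemma pure_fm_simps [simp]:
  "pure_fm oag FF"
  "pure_fm oag (Eq s t) \<longleftrightarrow> pure_trm oag s \<and> pure_trm oag t"
  "pure_fm oag (Less s t) \<longleftrightarrow> pure_trm oag s \<and> pure_trm oag t"
  "pure_fm oag (FNot \<phi>) \<longleftrightarrow> pure_fm oag \<phi>"
  "pure_fm oag (FConj \<phi> \<psi>) \<longleftrightarrow> pure_fm oag \<phi> \<and> pure_fm oag \<psi>"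
  "pure_fm oag (FEx k \<phi>) \<longleftrightarrow> pure_fm oag \<phi>"
  by (auto simp: pure_fm_def pure_trm_def in_lang_def)

lemma pure_trm_Var [simp]: "pure_trm oag (Var i)"
  by (simp add: pure_trm_def)

lemma sat_cong: "(\<And>v. v \<in> fv \<phi> \<Longrightarrow> e v = e' v) \<Longrightarrow> sat S e \<phi> = sat S e' \<phi>"
  unfolding sat_def by (rule holds_cong) auto

lemma tv_cong: "(\<And>v. v \<in> fvt t \<Longrightarrow> e v = e' v) \<Longrightarrow> tv S e t = tv S e' t"
  unfolding tv_def by (rule tval_cong) auto

lemma sat_sub: "sat S e (sub \<sigma> \<phi>) = sat S (\<lambda>v. tv S e (\<sigma> v)) \<phi>"
  unfolding sat_def tv_def by (rule holds_map_sub)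

lemma pure_fm_rename: "pure_fm oag \<phi> \<Longrightarrow> pure_fm oag (sub (\<lambda>v. Var (\<rho> v)) \<phi>)"
  using set_sub[of "\<lambda>v. Var (\<rho> v)" \<phi>] order_fm_sub[of \<phi> "\<lambda>v. Var (\<rho> v)"]
  by (auto simp: pure_fm_def in_lang_def)

definition exs :: "nat set \<Rightarrow> 'a fm \<Rightarrow> 'a fm" where
  "exs V \<phi> = foldr FEx (sorted_list_of_set V) \<phi>"

lemma sat_exs:
  assumes "finite V"
  shows "sat S e (exs V \<phi>) \<longleftrightarrow> (\<exists>e'. (\<forall>v. v \<notin> V \<longrightarrow> e' v = e v) \<and> sat S e' \<phi>)"
proof -
  have "sat S e (foldr FEx ks \<phi>) \<longleftrightarrow> (\<exists>e'. (\<forall>v. v \<notin> set ks \<longrightarrow> e' v = e v) \<and> sat S e' \<phi>)" for ks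
  proof (induction ks arbitrary: e)
    case Nil
    have "(\<forall>v. v \<notin> set [] \<longrightarrow> e' v = e v) \<longleftrightarrow> e' = e" for e' by (simp add: fun_eq_iff)
    then show ?case by simp
  next
    case (Cons k ks)
    show ?case
    proof
      assume "sat S e (foldr FEx (k # ks) \<phi>)"
      then obtain a where "sat S (e(k := a)) (foldr FEx ks \<phi>)" by auto
      then obtain e' where e': "\<forall>v. v \<notin> set ks \<longrightarrow> e' v = (e(k := a)) v" "sat S e' \<phi>"
        using Cons.IH by blast
      then show "\<exists>e'. (\<forall>v. v \<notin> set (k # ks) \<longrightarrow> e' v = e v) \<and> sat S e' \<phi>"
        by (intro exI[of _ e']) auto
    next
      assume "\<exists>e'. (\<forall>v. v \<notin> set (k # ks) \<longrightarrow> e' v = e v) \<and> sat S e' \<phi>"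
      then obtain e' where e': "\<forall>v. v \<notin> set (k # ks) \<longrightarrow> e' v = e v" "sat S e' \<phi>" by blast
      then have "\<forall>v. v \<notin> set ks \<longrightarrow> e' v = (e(k := e' k)) v" by auto
      with e'(2) have "sat S (e(k := e' k)) (foldr FEx ks \<phi>)" using Cons.IH by blast
      then show "sat S e (foldr FEx (k # ks) \<phi>)" by auto
    qed
  qed
  then show ?thesis using assms by (simp add: exs_def)
qed

lemma pure_fm_exs: "pure_fm oag \<phi> \<Longrightarrow> pure_fm oag (exs V \<phi>)"
proof -
  assume "pure_fm oag \<phi>"
  then have "pure_fm oag (foldr FEx ks \<phi>)" for ks by (induction ks) auto
  then show ?thesis by (simp add: exs_def)
qed

lemma fv_exs: "finite V \<Longrightarrow> fv (exs V \<phi>) = fv \<phi> - V"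
proof -
  have "fv (foldr FEx ks \<phi>) = fv \<phi> - set ks" for ks by (induction ks) auto
  then show "finite V \<Longrightarrow> ?thesis" by (simp add: exs_def)
qed

text \<open>\<open>models_T\<close> speaks of formulas whose parameter type is that of
  \<open>M\<close>. A pure formula contains no parameter, so passing from \<open>unit\<close> to
  that type and on to \<open>real\<close> changes nothing.\<close>

lemma models_T_sentence:
  assumes "models_T oag M" "pure_fm oag \<phi>" "fv \<phi> = {}"
  shows "sat M e \<phi> \<longleftrightarrow> sat real_struc e' \<phi>"
proof -
  let ?\<psi> = "map_fm (\<lambda>_. s_zero M) \<phi>"
  have "holds M e ?\<psi> \<longleftrightarrow> holds real_struc e' (map_fm (\<lambda>_. 0) ?\<psi>)"
    using assms unfolding models_T_def by (auto simp: pure_fm_def in_lang_def fm.set_map)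
  then show ?thesis by (simp add: sat_def fm.map_comp comp_def real_struc_def)
qed

section \<open>Corresponding first-order predicates on a model and on the reals\<close>

text \<open>A predicate on finitely many tuples (blocks) takes all of them in one argument
  \<open>B :: nat \<Rightarrow> nat \<Rightarrow> 'a\<close>, where \<open>B b i\<close> is the \<open>i\<close>-th entry of the \<open>b\<close>-th block.\<close>

definition flat :: "(nat \<Rightarrow> nat \<Rightarrow> 'b) \<Rightarrow> nat \<Rightarrow> 'b" where
  "flat B v = B (fst (prod_decode v)) (snd (prod_decode v))"

text \<open>Transfer needs formulas, but none has to be written out: pairs of predicates that share
  one defining formula are closed under connectives and quantifiers, so every notion is carried
  along together with its real counterpart.\<close>

definition fo :: "bool \<Rightarrow> 'a struc \<Rightarrow> ((nat \<Rightarrow> nat \<Rightarrow> 'a) \<Rightarrow> bool) \<Rightarrow> ((nat \<Rightarrow> nat \<Rightarrow> real) \<Rightarrow> bool) \<Rightarrow> bool"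
  where "fo oag M P Q \<longleftrightarrow> (\<exists>\<phi>. pure_fm oag \<phi> \<and>
    (\<forall>B. P B \<longleftrightarrow> sat M (flat B) \<phi>) \<and> (\<forall>B. Q B \<longleftrightarrow> sat real_struc (flat B) \<phi>))"

lemma foI:
  "pure_fm oag \<phi> \<Longrightarrow> (\<And>B. P B \<longleftrightarrow> sat M (flat B) \<phi>) \<Longrightarrow> (\<And>B. Q B \<longleftrightarrow> sat real_struc (flat B) \<phi>)
    \<Longrightarrow> fo oag M P Q"
  unfolding fo_def by blast

lemma foE:
  assumes "fo oag M P Q"
  obtains \<phi> where "pure_fm oag \<phi>" "P = (\<lambda>B. sat M (flat B) \<phi>)" "Q = (\<lambda>B. sat real_struc (flat B) \<phi>)"
  using assms unfolding fo_def by blast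

lemma ex_flat: "\<exists>B. flat B = e"
proof
  show "flat (\<lambda>b i. e (prod_encode (b, i))) = e" by (auto simp: flat_def)
qed

text \<open>Every assignment is \<open>flat B\<close> for some \<open>B\<close>, and only the free
  variables matter, so finitely many quantifiers express the quantifier over all
  \<open>B\<close>.\<close>

lemma sat_universal_closure:
  "sat S e (FNot (exs (fv \<phi>) (FNot \<phi>))) \<longleftrightarrow> (\<forall>B. sat S (flat B) \<phi>)"
proof -
  have "sat S e (FNot (exs (fv \<phi>) (FNot \<phi>)))
      \<longleftrightarrow> (\<forall>e'. (\<forall>v. v \<notin> fv \<phi> \<longrightarrow> e' v = e v) \<longrightarrow> sat S e' \<phi>)"
    by (auto simp: sat_exs)
  also have "\<dots> \<longleftrightarrow> (\<forall>e'. sat S e' \<phi>)"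
  proof (intro iffI allI)
    fix e' assume *: "\<forall>e'. (\<forall>v. v \<notin> fv \<phi> \<longrightarrow> e' v = e v) \<longrightarrow> sat S e' \<phi>"
    have "sat S (\<lambda>v. if v \<in> fv \<phi> then e' v else e v) \<phi>" using * by simp
    then show "sat S e' \<phi>" using sat_cong[of \<phi> "\<lambda>v. if v \<in> fv \<phi> then e' v else e v" e' S] by simp
  qed simp
  also have "\<dots> \<longleftrightarrow> (\<forall>B. sat S (flat B) \<phi>)" by (metis ex_flat)
  finally show ?thesis .
qed

lemma fo_transfer:
  assumes "models_T oag M" "fo oag M P Q"
  shows "(\<forall>B. P B) \<longleftrightarrow> (\<forall>B. Q B)"
proof -
  from assms(2) obtain \<phi> where \<phi>: "pure_fm oag \<phi>" "P = (\<lambda>B. sat M (flat B) \<phi>)"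
    "Q = (\<lambda>B. sat real_struc (flat B) \<phi>)" by (rule foE)
  let ?\<psi> = "FNot (exs (fv \<phi>) (FNot \<phi>))"
  have "fv ?\<psi> = {}" by (simp add: fv_exs)
  moreover have "pure_fm oag ?\<psi>" using \<phi>(1) by (simp add: pure_fm_exs)
  ultimately have "sat M (\<lambda>_. s_zero M) ?\<psi> \<longleftrightarrow> sat real_struc (\<lambda>_. 0) ?\<psi>"
    using models_T_sentence assms(1) by blast
  then show ?thesis unfolding sat_universal_closure by (simp only: \<phi>)
qed

lemma fo_False: "fo oag M (\<lambda>B. False) (\<lambda>B. False)"
  by (rule foI[of _ FF]) auto

lemma fo_not: "fo oag M P Q \<Longrightarrow> fo oag M (\<lambda>B. \<not> P B) (\<lambda>B. \<not> Q B)"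
  by (elim foE, rule foI[of _ "FNot _"]) auto

lemma fo_conj:
  assumes "fo oag M P Q" "fo oag M P' Q'"
  shows "fo oag M (\<lambda>B. P B \<and> P' B) (\<lambda>B. Q B \<and> Q' B)"
proof -
  from assms(1) obtain \<phi> where \<phi>: "pure_fm oag \<phi>" "P = (\<lambda>B. sat M (flat B) \<phi>)"
    "Q = (\<lambda>B. sat real_struc (flat B) \<phi>)" by (rule foE)
  from assms(2) obtain \<psi> where \<psi>: "pure_fm oag \<psi>" "P' = (\<lambda>B. sat M (flat B) \<psi>)"
    "Q' = (\<lambda>B. sat real_struc (flat B) \<psi>)" by (rule foE)
  show ?thesis by (intro foI[of _ "FConj \<phi> \<psi>"]) (auto simp: \<phi> \<psi>)
qed

lemma fo_const: "fo oag M (\<lambda>B. b) (\<lambda>B. b)"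
  using fo_False fo_not[OF fo_False] by (cases b) auto

lemma fo_imp:
  assumes "fo oag M P Q" "fo oag M P' Q'"
  shows "fo oag M (\<lambda>B. P B \<longrightarrow> P' B) (\<lambda>B. Q B \<longrightarrow> Q' B)"
  using fo_not[OF fo_conj[OF assms(1) fo_not[OF assms(2)]]] by simp

lemma fo_iff:
  assumes "fo oag M P Q" "fo oag M P' Q'"
  shows "fo oag M (\<lambda>B. P B = P' B) (\<lambda>B. Q B = Q' B)"
proof -
  have eq: "(a = b) = ((a \<longrightarrow> b) \<and> (b \<longrightarrow> a))" for a b by blast
  have "fo oag M (\<lambda>B. (P B \<longrightarrow> P' B) \<and> (P' B \<longrightarrow> P B)) (\<lambda>B. (Q B \<longrightarrow> Q' B) \<and> (Q' B \<longrightarrow> Q B))"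
    by (rule fo_conj[OF fo_imp[OF assms] fo_imp[OF assms(2,1)]])
  then show ?thesis by (simp only: eq)
qed

lemma fo_ball:
  assumes "finite A" "\<And>a. a \<in> A \<Longrightarrow> fo oag M (P a) (Q a)"
  shows "fo oag M (\<lambda>B. \<forall>a\<in>A. P a B) (\<lambda>B. \<forall>a\<in>A. Q a B)"
  using assms by (induction A rule: finite_induct) (auto intro: fo_const[of _ _ True, simplified] fo_conj)

lemma fo_sat:
  assumes "pure_fm oag \<phi>"
  shows "fo oag M (\<lambda>B. sat M (\<lambda>v. B (\<beta> v) (\<iota> v)) \<phi>) (\<lambda>B. sat real_struc (\<lambda>v. B (\<beta> v) (\<iota> v)) \<phi>)"
proof (rule foI)
  let ?\<psi> = "sub (\<lambda>v. Var (prod_encode (\<beta> v, \<iota> v))) \<phi>"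
  show "pure_fm oag ?\<psi>" using assms by (rule pure_fm_rename)
  show "sat M (\<lambda>v. B (\<beta> v) (\<iota> v)) \<phi> = sat M (flat B) ?\<psi>" for B
    by (simp add: sat_sub flat_def)
  show "sat real_struc (\<lambda>v. B (\<beta> v) (\<iota> v)) \<phi> = sat real_struc (flat B) ?\<psi>" for B
    by (simp add: sat_sub flat_def)
qed

text \<open>Only finitely many entries of a block occur in \<open>\<phi>\<close>, so a quantifier
  over an infinite block amounts to finitely many quantifiers over elements.\<close>

lemma sat_exs_block:
  "(\<exists>x. sat S (flat (B(b := x))) \<phi>) \<longleftrightarrow> sat S (flat B) (exs {v \<in> fv \<phi>. fst (prod_decode v) = b} \<phi>)"
  (is "_ \<longleftrightarrow> sat _ _ (exs ?V _)")
proof -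
  have fin: "finite ?V" by simp
  show ?thesis unfolding sat_exs[OF fin]
  proof
    assume "\<exists>x. sat S (flat (B(b := x))) \<phi>"
    then obtain x where x: "sat S (flat (B(b := x))) \<phi>" by blast
    let ?e = "\<lambda>v. if v \<in> ?V then flat (B(b := x)) v else flat B v"
    have "sat S ?e \<phi> = sat S (flat (B(b := x))) \<phi>"
      by (rule sat_cong) (auto simp: flat_def)
    with x have "sat S ?e \<phi>" by simp
    moreover have "\<forall>v. v \<notin> ?V \<longrightarrow> ?e v = flat B v" by simp
    ultimately show "\<exists>e'. (\<forall>v. v \<notin> ?V \<longrightarrow> e' v = flat B v) \<and> sat S e' \<phi>"
      by (intro exI[of _ ?e] conjI)
  next
    assume "\<exists>e'. (\<forall>v. v \<notin> ?V \<longrightarrow> e' v = flat B v) \<and> sat S e' \<phi>"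
    then obtain e' where e': "\<forall>v. v \<notin> ?V \<longrightarrow> e' v = flat B v" "sat S e' \<phi>" by blast
    let ?x = "\<lambda>i. e' (prod_encode (b, i))"
    have "sat S (flat (B(b := ?x))) \<phi> = sat S e' \<phi>"
    proof (rule sat_cong)
      fix v assume v: "v \<in> fv \<phi>"
      show "flat (B(b := ?x)) v = e' v"
      proof (cases "fst (prod_decode v) = b")
        case True
        then have "prod_encode (b, snd (prod_decode v)) = v" by auto
        then show ?thesis using True by (simp add: flat_def)
      next
        case False
        then show ?thesis using e'(1) by (simp add: flat_def)
      qed
    qed
    with e'(2) have "sat S (flat (B(b := ?x))) \<phi>" by simp
    then show "\<exists>x. sat S (flat (B(b := x))) \<phi>" by (rule exI[of _ ?x])
  qed
qed

lemma fo_ex_block: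
  assumes "fo oag M P Q"
  shows "fo oag M (\<lambda>B. \<exists>x. P (B(b := x))) (\<lambda>B. \<exists>x. Q (B(b := x)))"
proof -
  from assms obtain \<phi> where \<phi>: "pure_fm oag \<phi>" "P = (\<lambda>B. sat M (flat B) \<phi>)"
    "Q = (\<lambda>B. sat real_struc (flat B) \<phi>)" by (rule foE)
  show ?thesis unfolding \<phi>(2,3) sat_exs_block
    by (rule foI[OF pure_fm_exs[OF \<phi>(1)]]) simp_all
qed

text \<open>Block \<open>b\<close> stores the bound tuple. The last two assumptions are the
  freshness condition: apart from this, \<open>P\<close> and \<open>Q\<close> do not read block
  \<open>b\<close>.\<close>

lemma fo_ex:
  assumes "fo oag M (\<lambda>B. P B (B b)) (\<lambda>B. Q B (B b))"
    and "\<And>B x y. P (B(b := x)) y = P B y" "\<And>B x y. Q (B(b := x)) y = Q B y"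
  shows "fo oag M (\<lambda>B. \<exists>x. P B x) (\<lambda>B. \<exists>x. Q B x)"
  using fo_ex_block[OF assms(1), of b] assms(2,3) by simp

lemma fo_all:
  assumes "fo oag M (\<lambda>B. P B (B b)) (\<lambda>B. Q B (B b))"
    and "\<And>B x y. P (B(b := x)) y = P B y" "\<And>B x y. Q (B(b := x)) y = Q B y"
  shows "fo oag M (\<lambda>B. \<forall>x. P B x) (\<lambda>B. \<forall>x. Q B x)"
  using fo_not[OF fo_ex[of oag M "\<lambda>B x. \<not> P B x" b "\<lambda>B x. \<not> Q B x"]] fo_not[OF assms(1)] assms(2,3)
  by simp

section \<open>Quantifier elimination over the reals\<close>

lemma real_struc_simps [simp]:
  "s_less real_struc = (<)" "s_add real_struc = (+)" "s_neg real_struc = uminus" "s_zero real_struc = 0"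
  by (simp_all add: real_struc_def)

abbreviation rv :: "(nat \<Rightarrow> real) \<Rightarrow> unit trm \<Rightarrow> real" where
  "rv \<equiv> tv real_struc"

fun coef :: "nat \<Rightarrow> 'a trm \<Rightarrow> int" where
  "coef k (Var i) = (if i = k then 1 else 0)"
| "coef k (Par a) = 0"
| "coef k Zero = 0"
| "coef k (Add s t) = coef k s + coef k t"
| "coef k (Neg t) = - coef k t"

lemma rv_Par [simp]: "rv e (Par a) = 0"
  by (simp add: tv_def)

lemma rv_split: "rv (e(k := a)) t = real_of_int (coef k t) * a + rv (e(k := 0)) t"
  by (induction t) (auto simp: algebra_simps)

lemma rv_affine: "rv (\<lambda>v. (1 - r) * e v + r * e' v) t = (1 - r) * rv e t + r * rv e' t"
  by (induction t) (auto simp: algebra_simps)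

lemma rv_subt: "rv e (subt \<sigma> t) = rv (\<lambda>v. rv e (\<sigma> v)) t"
  by (induction t) auto

fun nmul :: "nat \<Rightarrow> 'a trm \<Rightarrow> 'a trm" where
  "nmul 0 t = Zero"
| "nmul (Suc n) t = Add t (nmul n t)"

definition imul :: "int \<Rightarrow> 'a trm \<Rightarrow> 'a trm" where
  "imul z t = (if z \<ge> 0 then nmul (nat z) t else Neg (nmul (nat (- z)) t))"

lemma rv_imul [simp]: "rv e (imul z t) = z * rv e t"
proof -
  have "rv e (nmul n t) = n * rv e t" for n by (induction n) (auto simp: algebra_simps)
  then show ?thesis by (simp add: imul_def)
qed

lemma set_imul: "set_trm (imul z t) \<subseteq> set_trm t"
proof -
  have "set_trm (nmul n t) \<subseteq> set_trm t" for n by (induction n) auto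
  then show ?thesis by (simp add: imul_def)
qed

section \<open>Positions relative to finitely many points of the line\<close>

lemma finite_separation:
  fixes A B :: "real set"
  assumes "finite A" "finite B" "\<And>a b. a \<in> A \<Longrightarrow> b \<in> B \<Longrightarrow> a < b"
  obtains c where "\<And>a. a \<in> A \<Longrightarrow> a < c" "\<And>b. b \<in> B \<Longrightarrow> c < b"
proof (cases "A = {} \<or> B = {}")
  case True
  then show ?thesis
  proof
    assume [simp]: "A = {}"
    show ?thesis
    proof (cases "B = {}")
      case False
      have "Min B - 1 < b" if "b \<in> B" for b using assms(2) that Min_le[of B b] by linarith
      then show ?thesis by (intro that[of "Min B - 1"]) auto
    qed (use that in auto)
  next
    assume [simp]: "B = {}"
    show ?thesis
    proof (cases "A = {}")
      case False
      have "a < Max A + 1" if "a \<in> A" for a using assms(1) that Max_ge[of A a] by linarith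
      then show ?thesis by (intro that[of "Max A + 1"]) auto
    qed (use that in auto)
  qed
next
  case False
  then have "Max A < Min B" using assms by simp
  then obtain c where "Max A < c" "c < Min B" using dense by blast
  then show ?thesis using assms(1,2) False by (intro that[of c]) auto
qed

text \<open>If \<open>a\<close> is one of the points, the corresponding point is taken. Otherwise
  \<open>a\<close> lies in a gap, and the matching gap is inhabited because the line is dense and
  has no endpoints.\<close>

lemma same_position:
  fixes r r' :: "'i \<Rightarrow> real"
  assumes "finite F" and ord: "\<And>f g. f \<in> F \<Longrightarrow> g \<in> F \<Longrightarrow> r f < r g \<longleftrightarrow> r' f < r' g"
  shows "\<exists>a'. \<forall>f\<in>F. (a < r f \<longleftrightarrow> a' < r' f) \<and> (r f < a \<longleftrightarrow> r' f < a')"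
proof (cases "\<exists>f\<in>F. r f = a")
  case True
  then show ?thesis using ord by metis
next
  case False
  obtain c where c: "\<And>x. x \<in> r' ` {f\<in>F. r f < a} \<Longrightarrow> x < c" "\<And>x. x \<in> r' ` {f\<in>F. a < r f} \<Longrightarrow> c < x"
    by (rule finite_separation[of "r' ` {f\<in>F. r f < a}" "r' ` {f\<in>F. a < r f}"])
      (use assms in \<open>auto simp flip: ord\<close>)
  have "(a < r f \<longleftrightarrow> c < r' f) \<and> (r f < a \<longleftrightarrow> r' f < c)" if f: "f \<in> F" for f
  proof (cases "r f < a")
    case True
    then show ?thesis using c(1)[of "r' f"] f by auto
  next
    case ge: False
    then have "a < r f" using False f by force
    then show ?thesis using c(2)[of "r' f"] f by auto
  qed
  then show ?thesis by blast
qed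

text \<open>The solution of \<open>s = t\<close> for variable \<open>k\<close>, provided that the
  coefficients of \<open>k\<close> differ.\<close>

definition root_of :: "nat \<Rightarrow> unit trm \<times> unit trm \<Rightarrow> (nat \<Rightarrow> real) \<Rightarrow> real" where
  "root_of k = (\<lambda>(s, t) e. (rv (e(k := 0)) t - rv (e(k := 0)) s) / (coef k s - coef k t))"

lemma less_iff_root:
  assumes "coef k s \<noteq> coef k t"
  shows "rv (e(k := a)) s < rv (e(k := a)) t \<longleftrightarrow>
    (if coef k s > coef k t then a < root_of k (s, t) e else root_of k (s, t) e < a)"
proof -
  let ?\<alpha> = "real_of_int (coef k s) - real_of_int (coef k t)"
  have "rv (e(k := a)) s < rv (e(k := a)) t \<longleftrightarrow> ?\<alpha> * a < rv (e(k := 0)) t - rv (e(k := 0)) s"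
    unfolding rv_split[of e k a] by (auto simp: algebra_simps)
  moreover have "?\<alpha> > 0 \<longleftrightarrow> coef k s > coef k t" "?\<alpha> \<noteq> 0" using assms by auto
  ultimately show ?thesis
    by (auto simp: root_of_def field_simps)
qed

text \<open>In the group language the quotients are compared after multiplication by the positive
  number \<open>(\<alpha> * \<alpha>')^2\<close>, which clears denominators and keeps the direction
  of the inequality whatever the signs. In the order language exactly one of the two variables is
  \<open>k\<close>, so the root is the other one.\<close>

lemma compare_roots:
  assumes "pure_trm oag s" "pure_trm oag t" "coef k s \<noteq> coef k t"
    and "pure_trm oag s'" "pure_trm oag t'" "coef k s' \<noteq> coef k t'"
  obtains u v where "pure_trm oag u" "pure_trm oag v"
    "\<And>e. rv e u < rv e v \<longleftrightarrow> root_of k (s, t) e < root_of k (s', t') e"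
proof (cases oag)
  case True
  define z :: "nat \<Rightarrow> unit trm" where "z = Var(k := Zero)"
  have z: "rv e (subt z t) = rv (e(k := 0)) t" for e t
    unfolding rv_subt by (rule tv_cong) (auto simp: z_def)
  have setz: "set_trm (subt z t) \<subseteq> set_trm t" for t
    using set_subt[of z t] by (auto simp: z_def split: if_splits)
  define \<alpha> \<alpha>' where "\<alpha> = coef k s - coef k t" and "\<alpha>' = coef k s' - coef k t'"
  define h h' where "h = Add (subt z t) (Neg (subt z s))" and "h' = Add (subt z t') (Neg (subt z s'))"
  define u v where "u = imul (\<alpha> * \<alpha>'\<^sup>2) h" and "v = imul (\<alpha>' * \<alpha>\<^sup>2) h'"
  have \<alpha>: "\<alpha> \<noteq> 0" "\<alpha>' \<noteq> 0" using assms by (auto simp: \<alpha>_def \<alpha>'_def)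
  show ?thesis
  proof (rule that)
    have "set_trm h = {}" "set_trm h' = {}"
      using assms setz[of s] setz[of t] setz[of s'] setz[of t'] by (simp_all add: h_def h'_def pure_trm_def)
    then show "pure_trm oag u" "pure_trm oag v"
      using True set_imul[of "\<alpha> * \<alpha>'\<^sup>2" h] set_imul[of "\<alpha>' * \<alpha>\<^sup>2" h']
      by (simp_all add: u_def v_def pure_trm_def)
    fix e
    have "root_of k (s, t) e = rv e h / \<alpha>" "root_of k (s', t') e = rv e h' / \<alpha>'"
      by (simp_all add: root_of_def h_def h'_def z \<alpha>_def \<alpha>'_def)
    moreover have "rv e h / \<alpha> < rv e h' / \<alpha>' \<longleftrightarrow>
        (rv e h / \<alpha>) * (\<alpha> * \<alpha>')\<^sup>2 < (rv e h' / \<alpha>') * (\<alpha> * \<alpha>')\<^sup>2"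
      by (rule mult_less_cancel_right_pos[symmetric]) (use \<alpha> in simp)
    moreover have "(rv e h / \<alpha>) * (\<alpha> * \<alpha>')\<^sup>2 = rv e u" "(rv e h' / \<alpha>') * (\<alpha> * \<alpha>')\<^sup>2 = rv e v"
      using \<alpha> by (simp_all add: u_def v_def power2_eq_square field_simps)
    ultimately show "rv e u < rv e v \<longleftrightarrow> root_of k (s, t) e < root_of k (s', t') e" by simp
  qed
next
  case False
  have other: "\<exists>i. \<forall>e. root_of k (s, t) e = e i"
    if st: "pure_trm oag s" "pure_trm oag t" "coef k s \<noteq> coef k t" for s t
  proof -
    have var: "\<exists>i. s = Var i" if "pure_trm oag s" for s
      using that False by (cases s) (auto simp: pure_trm_def)
    obtain i j where "s = Var i" "t = Var j" using var st by meson
    with st(3) show ?thesis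
      by (cases "i = k"; cases "j = k"; intro exI[of _ "if i = k then j else i"]) (auto simp: root_of_def)
  qed
  obtain i j where "\<And>e. root_of k (s, t) e = e i" "\<And>e. root_of k (s', t') e = e j"
    using other assms by meson
  then show ?thesis by (intro that[of "Var i" "Var j"]) auto
qed

definition same_order :: "(unit trm \<times> unit trm) set \<Rightarrow> (nat \<Rightarrow> real) \<Rightarrow> (nat \<Rightarrow> real) \<Rightarrow> bool" where
  "same_order A e e' \<longleftrightarrow> (\<forall>(s, t)\<in>A. rv e s < rv e t \<longleftrightarrow> rv e' s < rv e' t)"

definition pure_pairs :: "bool \<Rightarrow> (unit trm \<times> unit trm) set \<Rightarrow> bool" where
  "pure_pairs oag A \<longleftrightarrow> finite A \<and> (\<forall>(s, t)\<in>A. pure_trm oag s \<and> pure_trm oag t)"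

text \<open>A back-and-forth step. The position of \<open>a\<close> among the roots decides every
  comparison in which \<open>k\<close> does not cancel, and a matching \<open>a'\<close> exists once
  the roots are ordered alike. So \<open>A'\<close> collects the comparisons in which
  \<open>k\<close> cancels and all comparisons between roots.\<close>

lemma eliminate_variable:
  assumes "pure_pairs oag A"
  obtains A' where "pure_pairs oag A'"
    "\<And>e e' a. same_order A' e e' \<Longrightarrow> \<exists>a'. same_order A (e(k := a)) (e'(k := a'))"
proof -
  define F where "F = {(s, t)\<in>A. coef k s \<noteq> coef k t}"
  define W where "W P u v \<longleftrightarrow> pure_trm oag u \<and> pure_trm oag v \<and>
    (\<forall>e. rv e u < rv e v \<longleftrightarrow> root_of k (fst P) e < root_of k (snd P) e)" for P u v
  have "\<exists>u v. W P u v" if "P \<in> F \<times> F" for P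
  proof -
    obtain s t s' t' where P: "P = ((s, t), (s', t'))" by (metis surj_pair)
    show ?thesis
      by (rule compare_roots[of oag s t k s' t'])
        (use that assms in \<open>auto simp: P F_def W_def pure_pairs_def\<close>)
  qed
  then obtain u v where uv: "\<And>P. P \<in> F \<times> F \<Longrightarrow> W P (u P) (v P)" by metis
  define A' where "A' = {(s, t)\<in>A. coef k s = coef k t} \<union> (\<lambda>P. (u P, v P)) ` (F \<times> F)"
  have finF: "finite F" using assms by (auto simp: F_def pure_pairs_def intro: finite_subset[of _ A])
  have "finite {(s, t)\<in>A. coef k s = coef k t}"
    using assms by (auto simp: pure_pairs_def intro: finite_subset[of _ A])
  with finF have fin: "finite A'" by (simp add: A'_def)
  show ?thesis
  proof (rule that)
    show "pure_pairs oag A'"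
      using assms uv fin unfolding pure_pairs_def A'_def W_def by auto
    fix e e' a assume A': "same_order A' e e'"
    have "root_of k f e < root_of k g e \<longleftrightarrow> root_of k f e' < root_of k g e'" if "f \<in> F" "g \<in> F" for f g
    proof -
      have "(u (f, g), v (f, g)) \<in> A'" using that by (auto simp: A'_def)
      moreover have "W (f, g) (u (f, g)) (v (f, g))" using that uv by blast
      ultimately show ?thesis using A' by (auto simp: same_order_def W_def)
    qed
    then obtain a' where a': "\<And>f. f \<in> F \<Longrightarrow>
      (a < root_of k f e \<longleftrightarrow> a' < root_of k f e') \<and> (root_of k f e < a \<longleftrightarrow> root_of k f e' < a')"
      using same_position[OF finF, of "\<lambda>f. root_of k f e" "\<lambda>f. root_of k f e'" a] by blast
    have "rv (e(k := a)) s < rv (e(k := a)) t \<longleftrightarrow> rv (e'(k := a')) s < rv (e'(k := a')) t"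
      if st: "(s, t) \<in> A" for s t
    proof (cases "coef k s = coef k t")
      case True
      have "rv (e(k := a)) s < rv (e(k := a)) t \<longleftrightarrow> rv e s < rv e t" for e a
        using rv_split[of e k a s] rv_split[of e k a t] rv_split[of e k "e k" s] rv_split[of e k "e k" t]
          True by simp
      moreover have "rv e s < rv e t \<longleftrightarrow> rv e' s < rv e' t"
        using A' st True by (auto simp: same_order_def A'_def)
      ultimately show ?thesis by simp
    next
      case False
      then show ?thesis using a'[of "(s, t)"] st unfolding less_iff_root[OF False] by (auto simp: F_def)
    qed
    then show "\<exists>a'. same_order A (e(k := a)) (e'(k := a'))" unfolding same_order_def by blast
  qed
qed

lemma same_order_Un: "same_order (A \<union> A') e e' \<longleftrightarrow> same_order A e e' \<and> same_order A' e e'"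
  by (auto simp: same_order_def)

lemma same_order_sym: "same_order A e e' \<Longrightarrow> same_order A e' e"
  by (auto simp: same_order_def)

text \<open>Quantifier elimination in semantic form: no formula is rewritten, only a finite set of
  comparisons that decides the truth value is maintained. An existential quantifier is absorbed by
  moving its witness from \<open>e\<close> to \<open>e'\<close>, and back by symmetry.\<close>

lemma sat_determined_by_order:
  assumes "pure_fm oag \<phi>"
  obtains A where "pure_pairs oag A"
    "\<And>e e'. same_order A e e' \<Longrightarrow> sat real_struc e \<phi> = sat real_struc e' \<phi>"
proof -
  have "\<exists>A. pure_pairs oag A \<and> (\<forall>e e'. same_order A e e' \<longrightarrow> sat real_struc e \<phi> = sat real_struc e' \<phi>)"
    using assms
  proof (induction \<phi>)
    case FF
    show ?case by (intro exI[of _ "{}"]) (simp add: pure_pairs_def)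
  next
    case (Eq s t)
    then show ?case
      by (intro exI[of _ "{(s, t), (t, s)}"]) (auto simp: pure_pairs_def same_order_def)
  next
    case (Less s t)
    then show ?case by (intro exI[of _ "{(s, t)}"]) (auto simp: pure_pairs_def same_order_def)
  next
    case (FNot \<phi>)
    then show ?case by simp
  next
    case (FConj \<phi> \<psi>)
    then obtain A A' where "pure_pairs oag A" "pure_pairs oag A'"
      "\<forall>e e'. same_order A e e' \<longrightarrow> sat real_struc e \<phi> = sat real_struc e' \<phi>"
      "\<forall>e e'. same_order A' e e' \<longrightarrow> sat real_struc e \<psi> = sat real_struc e' \<psi>" by auto
    then show ?case by (intro exI[of _ "A \<union> A'"]) (auto simp: pure_pairs_def same_order_Un)
  next
    case (FEx k \<phi>)
    then obtain A where A: "pure_pairs oag A"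
      "\<And>e e'. same_order A e e' \<Longrightarrow> sat real_struc e \<phi> = sat real_struc e' \<phi>" by auto
    obtain A' where A': "pure_pairs oag A'"
      "\<And>e e' a. same_order A' e e' \<Longrightarrow> \<exists>a'. same_order A (e(k := a)) (e'(k := a'))"
      using eliminate_variable[OF A(1)] by metis
    have "sat real_struc e' (FEx k \<phi>)" if "same_order A' e e'" "sat real_struc e (FEx k \<phi>)" for e e'
      using that A'(2) A(2) by (metis sat_simps(6))
    then show ?case using A'(1) same_order_sym by blast
  qed
  then show ?thesis using that by blast
qed

section \<open>Crossing a single wall\<close>

text \<open>Convexity is formulated for an abstract operation \<open>mix r z z'\<close>, to be read as
  \<open>(1 - r) z + r z'\<close>, because the points are pairs of functions.\<close>

locale convex_region =
  fixes mix :: "real \<Rightarrow> 'z \<Rightarrow> 'z \<Rightarrow> 'z" and C :: "'z set"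
  assumes mix_in: "z \<in> C \<Longrightarrow> z' \<in> C \<Longrightarrow> 0 \<le> r \<Longrightarrow> r \<le> 1 \<Longrightarrow> mix r z z' \<in> C"
begin

definition affine :: "('z \<Rightarrow> real) \<Rightarrow> bool" where
  "affine h \<longleftrightarrow> (\<forall>r z z'. h (mix r z z') = (1 - r) * h z + r * h z')"

lemma affine_comb:
  assumes "affine g" "affine h"
  shows "affine (\<lambda>z. a * g z - b * h z)"
  unfolding affine_def
proof (intro allI)
  fix r z z'
  have gh: "g (mix r z z') = (1 - r) * g z + r * g z'" "h (mix r z z') = (1 - r) * h z + r * h z'"
    using assms by (auto simp: affine_def)
  show "a * g (mix r z z') - b * h (mix r z z') = (1 - r) * (a * g z - b * h z) + r * (a * g z' - b * h z')"
    unfolding gh by (simp add: algebra_simps)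
qed

lemma affine_minus_const: "affine g \<Longrightarrow> affine (\<lambda>z. g z - b)"
  by (auto simp: affine_def algebra_simps)

text \<open>Moving a little from \<open>w\<close> towards a point where \<open>h\<close> is nonzero
  makes \<open>h\<close> nonzero, and by continuity keeps the sign of every function that was
  nonzero before. Doing this once for each function yields the claim.\<close>

lemma generic_point:
  assumes fin: "finite H0" and aff: "\<And>h. h \<in> H0 \<Longrightarrow> affine h" and z': "z' \<in> C"
  shows "\<exists>w\<in>C. \<forall>h\<in>H0. (h z' \<noteq> 0 \<longrightarrow> sgn (h w) = sgn (h z')) \<and> ((\<exists>u\<in>C. h u \<noteq> 0) \<longrightarrow> h w \<noteq> 0)"
proof -
  have "\<exists>w\<in>C. (\<forall>h\<in>H0. h z' \<noteq> 0 \<longrightarrow> sgn (h w) = sgn (h z')) \<and> (\<forall>h\<in>H. (\<exists>u\<in>C. h u \<noteq> 0) \<longrightarrow> h w \<noteq> 0)"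
    if "finite H" "H \<subseteq> H0" for H
    using that
  proof (induction H rule: finite_induct)
    case empty
    then show ?case using z' by auto
  next
    case (insert h H)
    then obtain w where w: "w \<in> C" "\<forall>h\<in>H0. h z' \<noteq> 0 \<longrightarrow> sgn (h w) = sgn (h z')"
      "\<forall>h\<in>H. (\<exists>u\<in>C. h u \<noteq> 0) \<longrightarrow> h w \<noteq> 0" by auto
    show ?case
    proof (cases "h w = 0 \<and> (\<exists>u\<in>C. h u \<noteq> 0)")
      case False
      then show ?thesis using w by blast
    next
      case True
      then obtain u where u: "u \<in> C" "h u \<noteq> 0" by blast
      have near: "eventually (\<lambda>r. sgn (g (mix r w u)) = sgn (g w)) (at_right 0)"
        if "g \<in> H0" "g w \<noteq> 0" for g
      proof -
        have *: "((\<lambda>r. (1 - r) * g w + r * g u) \<longlongrightarrow> (1 - 0) * g w + 0 * g u) (at_right 0)"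
          by (intro tendsto_intros)
        have "g (mix r w u) = (1 - r) * g w + r * g u" for r
          using aff[OF that(1)] by (simp add: affine_def)
        then have lim: "((\<lambda>r. g (mix r w u)) \<longlongrightarrow> g w) (at_right 0)" using * by simp
        show ?thesis
        proof (cases "g w > 0")
          case True
          then show ?thesis using order_tendstoD(1)[OF lim, of 0] by (auto elim: eventually_mono)
        next
          case False
          with that have "g w < 0" by simp
          then show ?thesis using order_tendstoD(2)[OF lim, of 0] by (auto elim: eventually_mono)
        qed
      qed
      then have "eventually (\<lambda>r. \<forall>g\<in>{g\<in>H0. g w \<noteq> 0}. sgn (g (mix r w u)) = sgn (g w)) (at_right 0)"
        using fin by (intro eventually_ball_finite) auto
      moreover have "eventually (\<lambda>r::real. r \<in> {0<..<1}) (at_right 0)"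
        by (rule eventually_at_right_real) simp
      ultimately have "eventually (\<lambda>r. (\<forall>g\<in>{g\<in>H0. g w \<noteq> 0}. sgn (g (mix r w u)) = sgn (g w))
          \<and> r \<in> {0<..<1}) (at_right 0)" by (rule eventually_conj)
      then obtain r where r: "\<forall>g\<in>{g\<in>H0. g w \<noteq> 0}. sgn (g (mix r w u)) = sgn (g w)" "0 < r" "r < 1"
        using eventually_happens'[OF trivial_limit_at_right_real] by fastforce
      have "affine h" using insert.prems aff by auto
      then have "h (mix r w u) = (1 - r) * h w + r * h u" unfolding affine_def by blast
      then have hr: "h (mix r w u) \<noteq> 0" using True u r by simp
      show ?thesis
      proof (intro bexI[of _ "mix r w u"] conjI ballI impI)
        show "mix r w u \<in> C" using mix_in w(1) u(1) r by simp
        fix g assume g: "g \<in> H0" "g z' \<noteq> 0"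
        then have "sgn (g w) = sgn (g z')" using w by blast
        moreover from this have "g w \<noteq> 0" using g by (metis sgn_0_0)
        ultimately show "sgn (g (mix r w u)) = sgn (g z')" using r g by simp
      next
        fix g assume g: "g \<in> insert h H" "\<exists>u\<in>C. g u \<noteq> 0"
        show "g (mix r w u) \<noteq> 0"
        proof (cases "g = h")
          case False
          then have "g w \<noteq> 0" "g \<in> H0" using g w insert.prems by auto
          then have "sgn (g (mix r w u)) = sgn (g w)" using r by blast
          then show ?thesis using \<open>g w \<noteq> 0\<close> by (metis sgn_0_0)
        qed (use hr in simp)
      qed
    qed
  qed
  from this[OF fin subset_refl] show ?thesis by blast
qed

text \<open>Among the pairs of points off all walls on which \<open>D\<close> differs, one with the fewest separating
  walls is separated, after a generic perturbation, by multiples of a single wall only: two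
  non-proportional walls would be crossed at different times, and a point in between would
  give a pair with fewer separating walls.\<close>

lemma single_wall_crossing:
  fixes f p q :: "'k \<Rightarrow> 'z \<Rightarrow> real"
  assumes fin: "finite K" and "K' \<subseteq> K"
    and aff: "\<And>k. k \<in> K \<Longrightarrow> affine (f k)" "\<And>k. k \<in> K \<Longrightarrow> affine (p k)" "\<And>k. k \<in> K \<Longrightarrow> affine (q k)"
    and D: "\<And>z z'. z \<in> C \<Longrightarrow> z' \<in> C \<Longrightarrow> (\<And>k. k \<in> K \<Longrightarrow> sgn (f k z) = sgn (f k z')) \<Longrightarrow> D z = D z'"
    and nonconst: "\<And>k. k \<in> K' \<Longrightarrow> \<exists>u\<in>C. \<exists>v\<in>C. p k u \<noteq> p k v" "\<And>k. k \<in> K' \<Longrightarrow> \<exists>u\<in>C. \<exists>v\<in>C. q k u \<noteq> q k v"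
    and "z1 \<in> C" "z2 \<in> C" "\<And>k. k \<in> K \<Longrightarrow> f k z1 \<noteq> 0" "\<And>k. k \<in> K \<Longrightarrow> f k z2 \<noteq> 0"
    and "\<And>k. k \<in> K - K' \<Longrightarrow> sgn (f k z1) = sgn (f k z2)" "D z1 \<noteq> D z2"
  shows "\<exists>z\<in>C. \<exists>w\<in>C. \<exists>k\<in>K'. D z \<noteq> D w \<and> sgn (f k z) \<noteq> sgn (f k w) \<and> p k z \<noteq> p k w \<and> q k z \<noteq> q k w
    \<and> (\<forall>l\<in>K. f l z \<noteq> 0 \<and> f l w \<noteq> 0 \<and> (sgn (f l z) = sgn (f l w) \<or> (\<exists>c. \<forall>u\<in>C. f l u = c * f k u)))"
    (is ?goal)
proof -
  define diff where "diff z w = {k\<in>K. sgn (f k z) \<noteq> sgn (f k w)}" for z w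
  define off where "off z \<longleftrightarrow> z \<in> C \<and> (\<forall>k\<in>K. f k z \<noteq> 0)" for z
  have finK': "finite K'" using fin \<open>K' \<subseteq> K\<close> finite_subset by blast
  have "?goal" if "off z" "off z'" "D z \<noteq> D z'" "diff z z' \<subseteq> K'" for z z'
    using that
  proof (induction "card (diff z z')" arbitrary: z z' rule: less_induct)
    case less
    have z: "z \<in> C" "\<And>k. k \<in> K \<Longrightarrow> f k z \<noteq> 0" and z': "z' \<in> C" "\<And>k. k \<in> K \<Longrightarrow> f k z' \<noteq> 0"
      using less.prems by (auto simp: off_def)
    \<comment> \<open>\<open>h k l\<close> vanishes on the whole region exactly if
      \<open>f l\<close> is a multiple of \<open>f k\<close> there, as \<open>f k z\<close> is
      nonzero. A point \<open>w\<close> that is generic for \<open>H\<close> decides this by its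
      single value \<open>h k l w\<close>; the last two families in \<open>H\<close> make
      \<open>p\<close> and \<open>q\<close> at \<open>w\<close> differ from their values at
      \<open>z\<close>.\<close>
    define h where "h k l u = f k z * f l u - f l z * f k u" for k l u
    define H where "H = f ` K \<union> (\<lambda>(k, l). h k l) ` (K \<times> K)
      \<union> (\<lambda>k u. p k u - p k z) ` K' \<union> (\<lambda>k u. q k u - q k z) ` K'"
    have finH: "finite H" using fin finK' by (simp add: H_def)
    have affh: "affine (h k l)" if "k \<in> K" "l \<in> K" for k l
      unfolding h_def by (intro affine_comb aff that)
    have affH: "affine g" if "g \<in> H" for g
      using that affh aff \<open>K' \<subseteq> K\<close> by (auto simp: H_def intro!: affine_minus_const)
    obtain w where w: "w \<in> C" and wH: "\<And>g. g \<in> H \<Longrightarrow> g z' \<noteq> 0 \<Longrightarrow> sgn (g w) = sgn (g z')"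
      and wN: "\<And>g u. g \<in> H \<Longrightarrow> u \<in> C \<Longrightarrow> g u \<noteq> 0 \<Longrightarrow> g w \<noteq> 0"
      using generic_point[OF finH affH z'(1)] by blast
    have fw: "sgn (f k w) = sgn (f k z')" if "k \<in> K" for k
      by (rule wH) (use that z' in \<open>auto simp: H_def\<close>)
    have fw0: "f k w \<noteq> 0" if "k \<in> K" for k using fw[OF that] z'(2)[OF that] by (metis sgn_0_0)
    have Dw: "D w = D z'" using D w z' fw by blast
    have offw: "off w" using w fw0 by (simp add: off_def)
    have diffw: "diff z w = diff z z'" using fw by (auto simp: diff_def)
    have "diff z w \<noteq> {}"
      using D[OF z(1) w] less.prems(3) Dw by (auto simp: diff_def)
    show ?case
    proof (cases "\<exists>k l. k \<in> diff z w \<and> l \<in> diff z w \<and> h k l w \<noteq> 0")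
      case False
      obtain k where k: "k \<in> diff z w" using \<open>diff z w \<noteq> {}\<close> by blast
      then have kK: "k \<in> K'" "k \<in> K" using less.prems(4) diffw \<open>K' \<subseteq> K\<close> by auto
      have multiple: "\<exists>c. \<forall>u\<in>C. f l u = c * f k u" if l: "l \<in> K" "sgn (f l z) \<noteq> sgn (f l w)" for l
      proof -
        have "h k l \<in> H" using l kK by (auto simp: H_def)
        moreover have "h k l w = 0" using False k l by (auto simp: diff_def)
        ultimately have "h k l u = 0" if "u \<in> C" for u using wN that by blast
        then have "f l u = f l z / f k z * f k u" if "u \<in> C" for u
          using that z(2)[OF kK(2)] by (force simp: h_def field_simps)
        then show ?thesis by blast
      qed
      have pq: "p k w - p k z \<noteq> 0" "q k w - q k z \<noteq> 0"
      proof -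
        obtain u where "u \<in> C" "p k u - p k z \<noteq> 0"
          using nonconst(1)[OF kK(1)] by (metis eq_iff_diff_eq_0)
        moreover have "(\<lambda>u. p k u - p k z) \<in> H" using kK by (auto simp: H_def)
        ultimately show "p k w - p k z \<noteq> 0" using wN by blast
        obtain u where "u \<in> C" "q k u - q k z \<noteq> 0"
          using nonconst(2)[OF kK(1)] by (metis eq_iff_diff_eq_0)
        moreover have "(\<lambda>u. q k u - q k z) \<in> H" using kK by (auto simp: H_def)
        ultimately show "q k w - q k z \<noteq> 0" using wN by blast
      qed
      have "\<forall>l\<in>K. f l z \<noteq> 0 \<and> f l w \<noteq> 0 \<and> (sgn (f l z) = sgn (f l w) \<or> (\<exists>c. \<forall>u\<in>C. f l u = c * f k u))"
        using multiple z(2) fw0 by blast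
      moreover have "D z \<noteq> D w" "sgn (f k z) \<noteq> sgn (f k w)" "p k z \<noteq> p k w" "q k z \<noteq> q k w"
        using less.prems(3) Dw k pq by (auto simp: diff_def)
      ultimately show ?thesis using z(1) w kK(1) by blast
    next
      case True
      \<comment> \<open>The segment from \<open>z\<close> to \<open>w\<close> meets the wall
        \<open>k\<close> at time \<open>T k\<close>; equal times for two walls would make the
        corresponding \<open>h\<close> vanish at \<open>w\<close>.\<close>
      define T where "T k = f k z / (f k z - f k w)" for k
      have sg: "f k z * f k w < 0" if "k \<in> diff z w" for k
        using that z(2)[of k] fw0[of k] by (auto simp: diff_def sgn_if mult_less_0_iff split: if_splits)
      have T01: "0 < T k" "T k < 1" if "k \<in> diff z w" for k
        using sg[OF that] unfolding T_def by (auto simp: mult_less_0_iff field_simps)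
      have fT: "f k (mix r z w) = (f k z - f k w) * (T k - r)" if "k \<in> diff z w" for k r
      proof -
        have "k \<in> K" using that by (simp add: diff_def)
        then have fm: "f k (mix r z w) = (1 - r) * f k z + r * f k w" using aff(1) unfolding affine_def by blast
        have "f k z - f k w \<noteq> 0" using that by (auto simp: diff_def)
        then have "(f k z - f k w) * T k = f k z" by (simp add: T_def)
        then show ?thesis unfolding fm by (simp add: algebra_simps)
      qed
      obtain k0 l0 where kl0: "k0 \<in> diff z w" "l0 \<in> diff z w" "h k0 l0 w \<noteq> 0" using True by blast
      have "T k0 \<noteq> T l0"
      proof
        assume eq: "T k0 = T l0"
        have "f k0 z - f k0 w \<noteq> 0" "f l0 z - f l0 w \<noteq> 0" using kl0 by (auto simp: diff_def)
        with eq have "f k0 z * (f l0 z - f l0 w) = f l0 z * (f k0 z - f k0 w)"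
          by (simp add: T_def frac_eq_eq)
        then show False using kl0(3) by (simp add: h_def algebra_simps)
      qed
      then obtain k l where kl: "k \<in> diff z w" "l \<in> diff z w" "T k < T l"
        using kl0 by (metis linorder_neqE)
      \<comment> \<open>At a time strictly between two crossings, and itself not a crossing, the
        point is off all walls, has passed \<open>k\<close> and has not yet reached
        \<open>l\<close>. Each part of the segment is separated by fewer walls, and \<open>D\<close>
        changes along one of the parts.\<close>
      have "infinite ({T k<..<T l} - T ` K)" using kl(3) fin infinite_Ioo by (intro Diff_infinite_finite) auto
      then obtain r where r: "T k < r" "r < T l" "r \<notin> T ` K"
        by (metis DiffE ex_in_conv finite.emptyI greaterThanLessThan_iff)
      have r01: "0 \<le> r" "r \<le> 1" using r T01[OF kl(1)] T01[OF kl(2)] by auto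
      let ?m = "mix r z w"
      have mC: "?m \<in> C" using mix_in z(1) w r01 by blast
      have same: "sgn (f g ?m) = sgn (f g z)" if "g \<in> K" "g \<notin> diff z w" for g
      proof -
        have eq: "f g ?m = (1 - r) * f g z + r * f g w" using that aff(1) unfolding affine_def by blast
        have "sgn (f g z) = sgn (f g w)" using that by (auto simp: diff_def)
        then show ?thesis
        proof (cases "f g z > 0")
          case True
          then have "f g w > 0" using \<open>sgn (f g z) = sgn (f g w)\<close> by (metis sgn_1_pos)
          then have "r * f g w > 0" "(1 - r) * f g z \<ge> 0" using True r01 T01[OF kl(1)] r(1) by auto
          then show ?thesis unfolding eq using True by (auto simp: sgn_if)
        next
          case False
          then have "f g z < 0" using z(2) that by force
          then have "f g w < 0" using \<open>sgn (f g z) = sgn (f g w)\<close> by (metis sgn_1_neg)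
          then have "r * f g w < 0" "(1 - r) * f g z \<le> 0" using \<open>f g z < 0\<close> r01 T01[OF kl(1)] r(1)
            by (auto simp: mult_less_0_iff mult_le_0_iff)
          then show ?thesis unfolding eq using \<open>f g z < 0\<close> by (auto simp: sgn_if)
        qed
      qed
      have fm0: "f g ?m \<noteq> 0" if "g \<in> K" for g
      proof (cases "g \<in> diff z w")
        case True
        then show ?thesis using fT[OF True] r(3) that by (auto simp: diff_def)
      next
        case False
        then show ?thesis using same[OF that] z(2)[OF that] by (metis sgn_0_0)
      qed
      have offm: "off ?m" using mC fm0 by (simp add: off_def)
      have km: "sgn (f k ?m) = sgn (f k w)"
        using sg[OF kl(1)] r(1) unfolding fT[OF kl(1)]
        by (auto simp: sgn_if mult_less_0_iff zero_less_mult_iff)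
      have lm: "sgn (f l ?m) = sgn (f l z)"
        using sg[OF kl(2)] r(2) unfolding fT[OF kl(2)]
        by (auto simp: sgn_if mult_less_0_iff zero_less_mult_iff)
      have sub1: "diff z ?m \<subseteq> diff z w - {l}" using same lm by (auto simp: diff_def)
      have sub2: "diff ?m w \<subseteq> diff z w - {k}" using same km by (fastforce simp: diff_def)
      have fd: "finite (diff z w)" using fin by (simp add: diff_def)
      have c1: "card (diff z ?m) < card (diff z z')" "card (diff ?m w) < card (diff z z')"
        unfolding diffw[symmetric] using sub1 sub2 kl fd by (auto intro!: psubset_card_mono)
      show ?thesis
      proof (cases "D z = D ?m")
        case True
        then have "D ?m \<noteq> D w" using less.prems(3) Dw by simp
        then show ?thesis using less.hyps[OF c1(2) offm offw] sub2 less.prems(4) diffw by blast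
      next
        case False
        then show ?thesis using less.hyps[OF c1(1) less.prems(1) offm] sub1 less.prems(4) diffw by blast
      qed
    qed
  qed
  then show ?thesis using assms(9-) by (force simp: off_def diff_def)
qed

end

section \<open>Separated formulas\<close>

text \<open>Even variables stand for the entries of the pair of tuples \<open>(x, y)\<close>, all other variables
  for parameters.\<close>

definition comb :: "nat \<Rightarrow> nat \<Rightarrow> (nat \<Rightarrow> 'b) \<Rightarrow> (nat \<Rightarrow> 'b) \<Rightarrow> (nat \<Rightarrow> 'b) \<Rightarrow> nat \<Rightarrow> 'b" where
  "comb m n x y c v = (if odd v \<or> m + n \<le> v div 2 then c v
     else if v div 2 < m then x (v div 2) else y (v div 2 - m))"

lemma comb_blocks:
  "comb m n (B i) (B j) (B k) = (\<lambda>v. B (if odd v \<or> m + n \<le> v div 2 then k else if v div 2 < m then i else j)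
     (if odd v \<or> m + n \<le> v div 2 then v else if v div 2 < m then v div 2 else v div 2 - m))"
  by (auto simp: comb_def fun_eq_iff)

lemma tv_subt: "tv S e (subt \<sigma> t) = tv S (\<lambda>v. tv S e (\<sigma> v)) t"
  unfolding tv_def by (rule tval_subt)

lemma pure_trm_rename: "pure_trm oag t \<Longrightarrow> pure_trm oag (subt (\<lambda>v. Var (\<rho> v)) t)"
  using set_subt[of "\<lambda>v. Var (\<rho> v)" t] order_trm_subt[of t "\<lambda>v. Var (\<rho> v)"]
  by (auto simp: pure_trm_def)

text \<open>The formula \<open>\<phi>\<close> depends on the walls \<open>p(x) = q(y)\<close> for \<open>(p, q) \<in> K\<close> and on the order relations
  \<open>PX\<close> and \<open>PY\<close> between terms in \<open>x\<close> alone and in \<open>y\<close> alone. A term is made to depend on \<open>x\<close> alone by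
  feeding it parameters in place of \<open>y\<close>.\<close>

locale separated =
  fixes oag :: bool and m n :: nat and K PX PY :: "(unit trm \<times> unit trm) set" and \<phi> :: "unit fm"
  assumes K: "pure_pairs oag K" and PX: "pure_pairs oag PX" and PY: "pure_pairs oag PY"
    and \<phi>: "pure_fm oag \<phi>"
begin

definition xv :: "'b struc \<Rightarrow> (nat \<Rightarrow> 'b) \<Rightarrow> (nat \<Rightarrow> 'b) \<Rightarrow> unit trm \<Rightarrow> 'b" where
  "xv S c x t = tv S (comb m n x c c) t"

definition yv :: "'b struc \<Rightarrow> (nat \<Rightarrow> 'b) \<Rightarrow> (nat \<Rightarrow> 'b) \<Rightarrow> unit trm \<Rightarrow> 'b" where
  "yv S c y t = tv S (comb m n c y c) t"

definition rel :: "'b struc \<Rightarrow> (nat \<Rightarrow> 'b) \<Rightarrow> (nat \<Rightarrow> 'b) \<Rightarrow> (nat \<Rightarrow> 'b) \<Rightarrow> bool" where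
  "rel S c x y \<longleftrightarrow> sat S (comb m n x y c) \<phi>"

definition cellX :: "'b struc \<Rightarrow> (unit trm \<times> unit trm) set \<Rightarrow> (nat \<Rightarrow> 'b) \<Rightarrow> (nat \<Rightarrow> 'b) \<Rightarrow> bool" where
  "cellX S \<xi> c x \<longleftrightarrow> (\<forall>a\<in>PX. s_less S (xv S c x (fst a)) (xv S c x (snd a)) = (a \<in> \<xi>))"

definition cellY :: "'b struc \<Rightarrow> (unit trm \<times> unit trm) set \<Rightarrow> (nat \<Rightarrow> 'b) \<Rightarrow> (nat \<Rightarrow> 'b) \<Rightarrow> bool" where
  "cellY S \<eta> c y \<longleftrightarrow> (\<forall>a\<in>PY. s_less S (yv S c y (fst a)) (yv S c y (snd a)) = (a \<in> \<eta>))"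

definition below :: "'b struc \<Rightarrow> unit trm \<times> unit trm \<Rightarrow> (nat \<Rightarrow> 'b) \<Rightarrow> (nat \<Rightarrow> 'b) \<Rightarrow> (nat \<Rightarrow> 'b) \<Rightarrow> bool" where
  "below S k c x y \<longleftrightarrow> s_less S (xv S c x (fst k)) (yv S c y (snd k))"

definition above :: "'b struc \<Rightarrow> unit trm \<times> unit trm \<Rightarrow> (nat \<Rightarrow> 'b) \<Rightarrow> (nat \<Rightarrow> 'b) \<Rightarrow> (nat \<Rightarrow> 'b) \<Rightarrow> bool" where
  "above S k c x y \<longleftrightarrow> s_less S (yv S c y (snd k)) (xv S c x (fst k))"

definition onwall :: "'b struc \<Rightarrow> unit trm \<times> unit trm \<Rightarrow> (nat \<Rightarrow> 'b) \<Rightarrow> (nat \<Rightarrow> 'b) \<Rightarrow> (nat \<Rightarrow> 'b) \<Rightarrow> bool" where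
  "onwall S k c x y \<longleftrightarrow> xv S c x (fst k) = yv S c y (snd k)"

definition agree :: "'b struc \<Rightarrow> (unit trm \<times> unit trm) set \<Rightarrow> (nat \<Rightarrow> 'b) \<Rightarrow> (nat \<Rightarrow> 'b) \<Rightarrow> (nat \<Rightarrow> 'b) \<Rightarrow> bool" where
  "agree S E c x y \<longleftrightarrow> (\<forall>k\<in>E. onwall S k c x y)"

definition exact :: "'b struc \<Rightarrow> (unit trm \<times> unit trm) set \<Rightarrow> (nat \<Rightarrow> 'b) \<Rightarrow> (nat \<Rightarrow> 'b) \<Rightarrow> (nat \<Rightarrow> 'b) \<Rightarrow> bool" where
  "exact S E c x y \<longleftrightarrow> (\<forall>k\<in>K. onwall S k c x y = (k \<in> E))"

text \<open>Meant for walls whose \<open>q\<close> is constant on the fibre: there it tells the side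
  of the wall from \<open>x\<close> alone, without naming the constant.\<close>

definition belowX where
  "belowX S E \<eta> c x k \<longleftrightarrow> (\<forall>y. cellY S \<eta> c y \<and> agree S E c x y \<longrightarrow> below S k c x y)"

definition belowY where
  "belowY S E \<xi> c y k \<longleftrightarrow> (\<forall>x. cellX S \<xi> c x \<and> agree S E c x y \<longrightarrow> below S k c x y)"

text \<open>Neighbourhoods are boxes given by their corners, since a distance cannot be expressed in
  the pure order language.\<close>

definition inbox :: "'b struc \<Rightarrow> nat \<Rightarrow> (nat \<Rightarrow> 'b) \<Rightarrow> (nat \<Rightarrow> 'b) \<Rightarrow> (nat \<Rightarrow> 'b) \<Rightarrow> bool" where
  "inbox S r l u x \<longleftrightarrow> (\<forall>i\<in>{..<r}. s_less S (l i) (x i) \<and> s_less S (x i) (u i))"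

definition nearX where
  "nearX S E \<xi> c y0 l u x \<longleftrightarrow> cellX S \<xi> c x \<and> agree S E c x y0 \<and> inbox S m l u x"

definition nearY where
  "nearY S E \<eta> c x0 l u y \<longleftrightarrow> cellY S \<eta> c y \<and> agree S E c x0 y \<and> inbox S n l u y"

text \<open>A first-order condition that forces an infinite half graph: in the product of two boxes within
  the fibres, the formula or its negation is the strict order between \<open>p(x)\<close> and \<open>q(y)\<close>, which both
  take all values in an interval.\<close>

definition wit where
  "wit S E \<xi> \<eta> k b c \<longleftrightarrow> (\<exists>x0 y0 l u l' u' g h. s_less S g h
    \<and> (\<forall>w. s_less S g w \<and> s_less S w h \<longrightarrow> (\<exists>x. nearX S E \<xi> c y0 l u x \<and> xv S c x (fst k) = w))
    \<and> (\<forall>w. s_less S g w \<and> s_less S w h \<longrightarrow> (\<exists>y. nearY S E \<eta> c x0 l' u' y \<and> yv S c y (snd k) = w))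
    \<and> (\<forall>x y. nearX S E \<xi> c y0 l u x \<and> nearY S E \<eta> c x0 l' u' y \<longrightarrow>
        (below S k c x y \<longrightarrow> rel S c x y = b) \<and> (above S k c x y \<longrightarrow> rel S c x y = (\<not> b))))"

text \<open>The condition \<open>agree S E c x y'\<close> makes the two pairs share their common
  values: for walls in \<open>E\<close> it gives \<open>p(x) = q(y') = p(x')\<close>, and likewise
  \<open>q(y) = p(x) = q(y')\<close>.\<close>

definition homogeneous where
  "homogeneous S E \<xi> \<eta> c \<longleftrightarrow> (\<forall>x y x' y'.
    (cellX S \<xi> c x \<and> cellX S \<xi> c x' \<and> cellY S \<eta> c y \<and> cellY S \<eta> c y' \<and>
     exact S E c x y \<and> exact S E c x' y' \<and> agree S E c x y' \<and>
     (\<forall>k\<in>K. belowX S E \<eta> c x k = belowX S E \<eta> c x' k) \<and>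
     (\<forall>k\<in>K. belowY S E \<xi> c y k = belowY S E \<xi> c y' k)) \<longrightarrow>
    rel S c x y = rel S c x' y')"

definition dichotomy where
  "dichotomy S E \<xi> \<eta> c \<longleftrightarrow>
    ((\<forall>k\<in>K. \<not> wit S E \<xi> \<eta> k True c \<and> \<not> wit S E \<xi> \<eta> k False c) \<longrightarrow> homogeneous S E \<xi> \<eta> c)"

end

section \<open>The notions above as first-order predicates\<close>

lemma fo_tv_less:
  assumes "pure_trm oag s" "pure_trm oag t"
  shows "fo oag M (\<lambda>B. s_less M (tv M (\<lambda>v. B (\<beta> v) (\<iota> v)) s) (tv M (\<lambda>v. B (\<beta>' v) (\<iota>' v)) t))
    (\<lambda>B. s_less real_struc (rv (\<lambda>v. B (\<beta> v) (\<iota> v)) s) (rv (\<lambda>v. B (\<beta>' v) (\<iota>' v)) t))"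
  by (rule foI[of _ "Less (subt (\<lambda>v. Var (prod_encode (\<beta> v, \<iota> v))) s) (subt (\<lambda>v. Var (prod_encode (\<beta>' v, \<iota>' v))) t)"])
    (use assms in \<open>simp_all add: pure_trm_rename tv_subt flat_def\<close>)

lemma fo_tv_eq:
  assumes "pure_trm oag s" "pure_trm oag t"
  shows "fo oag M (\<lambda>B. tv M (\<lambda>v. B (\<beta> v) (\<iota> v)) s = tv M (\<lambda>v. B (\<beta>' v) (\<iota>' v)) t)
    (\<lambda>B. rv (\<lambda>v. B (\<beta> v) (\<iota> v)) s = rv (\<lambda>v. B (\<beta>' v) (\<iota>' v)) t)"
  by (rule foI[of _ "Eq (subt (\<lambda>v. Var (prod_encode (\<beta> v, \<iota> v))) s) (subt (\<lambda>v. Var (prod_encode (\<beta>' v, \<iota>' v))) t)"])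
    (use assms in \<open>simp_all add: pure_trm_rename tv_subt flat_def\<close>)

lemma fo_entry_less: "fo oag M (\<lambda>B. s_less M (B i a) (B j b)) (\<lambda>B. s_less real_struc (B i a) (B j b))"
  using fo_sat[of oag "Less (Var 0) (Var 1)" M "\<lambda>v. if v = 0 then i else j" "\<lambda>v. if v = 0 then a else b"]
  by simp

lemma ex_entry: "(\<exists>a. P a) \<longleftrightarrow> (\<exists>x :: nat \<Rightarrow> 'b. P (x 0))"
proof
  assume "\<exists>a. P a"
  then obtain a where "P a" by blast
  then show "\<exists>x :: nat \<Rightarrow> 'b. P (x 0)" by (intro exI[of _ "\<lambda>_. a"])
qed blast

text \<open>A quantifier over single elements is one over blocks of which only the entry \<open>0\<close> matters.\<close>

lemma fo_ex_entry:
  assumes "fo oag M (\<lambda>B. P B (B b 0)) (\<lambda>B. Q B (B b 0))"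
    and "\<And>B x y. P (B(b := x)) y = P B y" "\<And>B x y. Q (B(b := x)) y = Q B y"
  shows "fo oag M (\<lambda>B. \<exists>x. P B x) (\<lambda>B. \<exists>x. Q B x)"
proof -
  have "fo oag M (\<lambda>B. \<exists>x :: nat \<Rightarrow> _. P B (x 0)) (\<lambda>B. \<exists>x :: nat \<Rightarrow> _. Q B (x 0))"
    by (rule fo_ex[where b = b]) (use assms in simp_all)
  then show ?thesis unfolding ex_entry[symmetric] .
qed

lemma fo_all_entry:
  assumes "fo oag M (\<lambda>B. P B (B b 0)) (\<lambda>B. Q B (B b 0))"
    and "\<And>B x y. P (B(b := x)) y = P B y" "\<And>B x y. Q (B(b := x)) y = Q B y"
  shows "fo oag M (\<lambda>B. \<forall>x. P B x) (\<lambda>B. \<forall>x. Q B x)"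
  using fo_not[OF fo_ex_entry[of oag M "\<lambda>B x. \<not> P B x" b "\<lambda>B x. \<not> Q B x"]] fo_not[OF assms(1)] assms(2,3)
  by simp

context separated
begin

lemma fo_rel: "fo oag M (\<lambda>B. rel M (B k) (B i) (B j)) (\<lambda>B. rel real_struc (B k) (B i) (B j))"
  unfolding rel_def comb_blocks by (rule fo_sat[OF \<phi>])

lemma pure_K: "k \<in> K \<Longrightarrow> pure_trm oag (fst k)" "k \<in> K \<Longrightarrow> pure_trm oag (snd k)"
  and pure_PX: "a \<in> PX \<Longrightarrow> pure_trm oag (fst a)" "a \<in> PX \<Longrightarrow> pure_trm oag (snd a)"
  and pure_PY: "a \<in> PY \<Longrightarrow> pure_trm oag (fst a)" "a \<in> PY \<Longrightarrow> pure_trm oag (snd a)"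
  using K PX PY by (auto simp: pure_pairs_def)

lemma finite_K: "finite K" and finite_PX: "finite PX" and finite_PY: "finite PY"
  using K PX PY by (auto simp: pure_pairs_def)

lemma fo_cellX: "fo oag M (\<lambda>B. cellX M \<xi> (B 0) (B i)) (\<lambda>B. cellX real_struc \<xi> (B 0) (B i))"
  unfolding cellX_def xv_def comb_blocks
  by (intro fo_ball fo_iff fo_const fo_tv_less finite_PX pure_PX)

lemma fo_cellY: "fo oag M (\<lambda>B. cellY M \<eta> (B 0) (B i)) (\<lambda>B. cellY real_struc \<eta> (B 0) (B i))"
  unfolding cellY_def yv_def comb_blocks
  by (intro fo_ball fo_iff fo_const fo_tv_less finite_PY pure_PY)

lemma fo_below:
  assumes "k \<in> K"
  shows "fo oag M (\<lambda>B. below M k (B 0) (B i) (B j)) (\<lambda>B. below real_struc k (B 0) (B i) (B j))"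
  unfolding below_def xv_def yv_def comb_blocks by (intro fo_tv_less pure_K assms)

lemma fo_above:
  assumes "k \<in> K"
  shows "fo oag M (\<lambda>B. above M k (B 0) (B i) (B j)) (\<lambda>B. above real_struc k (B 0) (B i) (B j))"
  unfolding above_def xv_def yv_def comb_blocks by (intro fo_tv_less pure_K assms)

lemma fo_onwall:
  assumes "k \<in> K"
  shows "fo oag M (\<lambda>B. onwall M k (B 0) (B i) (B j)) (\<lambda>B. onwall real_struc k (B 0) (B i) (B j))"
  unfolding onwall_def xv_def yv_def comb_blocks by (intro fo_tv_eq pure_K assms)

lemma fo_xv_entry:
  assumes "k \<in> K"
  shows "fo oag M (\<lambda>B. xv M (B 0) (B i) (fst k) = B j 0) (\<lambda>B. xv real_struc (B 0) (B i) (fst k) = B j 0)"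
  using fo_tv_eq[OF pure_K(1)[OF assms] pure_trm_Var[of oag 0], of M _ _ "\<lambda>v. j" "\<lambda>v. 0"]
  unfolding xv_def comb_blocks by simp

lemma fo_yv_entry:
  assumes "k \<in> K"
  shows "fo oag M (\<lambda>B. yv M (B 0) (B i) (snd k) = B j 0) (\<lambda>B. yv real_struc (B 0) (B i) (snd k) = B j 0)"
  using fo_tv_eq[OF pure_K(2)[OF assms] pure_trm_Var[of oag 0], of M _ _ "\<lambda>v. j" "\<lambda>v. 0"]
  unfolding yv_def comb_blocks by simp

lemma fo_agree:
  assumes "E \<subseteq> K"
  shows "fo oag M (\<lambda>B. agree M E (B 0) (B i) (B j)) (\<lambda>B. agree real_struc E (B 0) (B i) (B j))"
  unfolding agree_def by (intro fo_ball fo_onwall) (use assms finite_K finite_subset in auto)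

lemma fo_exact: "fo oag M (\<lambda>B. exact M E (B 0) (B i) (B j)) (\<lambda>B. exact real_struc E (B 0) (B i) (B j))"
  unfolding exact_def by (intro fo_ball fo_iff fo_const fo_onwall finite_K)

lemma fo_belowX:
  assumes "E \<subseteq> K" "k \<in> K" "i \<noteq> 9"
  shows "fo oag M (\<lambda>B. belowX M E \<eta> (B 0) (B i) k) (\<lambda>B. belowX real_struc E \<eta> (B 0) (B i) k)"
  unfolding belowX_def
  \<comment> \<open>Block 9 is kept for the bound tuple, whence the assumption on
    \<open>i\<close>.\<close>
  by (rule fo_all[where b = 9])
    (use assms in \<open>auto intro!: fo_imp fo_conj fo_cellY fo_agree fo_below\<close>)

lemma fo_belowY:
  assumes "E \<subseteq> K" "k \<in> K" "i \<noteq> 9"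
  shows "fo oag M (\<lambda>B. belowY M E \<xi> (B 0) (B i) k) (\<lambda>B. belowY real_struc E \<xi> (B 0) (B i) k)"
  unfolding belowY_def
  by (rule fo_all[where b = 9])
    (use assms in \<open>auto intro!: fo_imp fo_conj fo_cellX fo_agree fo_below\<close>)

lemma fo_inbox: "fo oag M (\<lambda>B. inbox M r (B i) (B j) (B k)) (\<lambda>B. inbox real_struc r (B i) (B j) (B k))"
  unfolding inbox_def by (intro fo_ball fo_conj fo_entry_less) simp

lemma fo_nearX:
  assumes "E \<subseteq> K"
  shows "fo oag M (\<lambda>B. nearX M E \<xi> (B 0) (B i) (B j) (B l) (B x)) (\<lambda>B. nearX real_struc E \<xi> (B 0) (B i) (B j) (B l) (B x))"
  unfolding nearX_def by (intro fo_conj fo_cellX fo_agree fo_inbox assms)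

lemma fo_nearY:
  assumes "E \<subseteq> K"
  shows "fo oag M (\<lambda>B. nearY M E \<eta> (B 0) (B i) (B j) (B l) (B x)) (\<lambda>B. nearY real_struc E \<eta> (B 0) (B i) (B j) (B l) (B x))"
  unfolding nearY_def by (intro fo_conj fo_cellY fo_agree fo_inbox assms)

lemma fo_wit:
  assumes "E \<subseteq> K" "k \<in> K"
  shows "fo oag M (\<lambda>B. wit M E \<xi> \<eta> k b (B 0)) (\<lambda>B. wit real_struc E \<xi> \<eta> k b (B 0))"
  unfolding wit_def
  \<comment> \<open>Block 0 holds the parameters, blocks 1 to 8 the witnesses \<open>x0\<close> to
    \<open>h\<close>, and blocks 9 and 10 the variables of the inner quantifiers.\<close>
  apply (rule fo_ex[where b = 1], rule fo_ex[where b = 2], rule fo_ex[where b = 3], rule fo_ex[where b = 4])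
         apply (rule fo_ex[where b = 5], rule fo_ex[where b = 6])
           apply (rule fo_ex_entry[where b = 7], rule fo_ex_entry[where b = 8])
             apply (intro fo_conj)
                apply (rule fo_entry_less)
               apply (rule fo_all_entry[where b = 9])
                 apply (intro fo_imp fo_conj fo_entry_less)
                 apply (rule fo_ex[where b = 10], intro fo_conj fo_nearX fo_xv_entry assms)
                  apply simp_all[4]
              apply (rule fo_all_entry[where b = 9])
                apply (intro fo_imp fo_conj fo_entry_less)
                apply (rule fo_ex[where b = 10], intro fo_conj fo_nearY fo_yv_entry assms)
                 apply simp_all[4]
             apply (rule fo_all[where b = 9], rule fo_all[where b = 10])
               apply (intro fo_imp fo_conj fo_nearX fo_nearY fo_below fo_above fo_iff fo_rel fo_const assms)
              apply simp_all
  done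

lemma fo_homogeneous:
  assumes "E \<subseteq> K"
  shows "fo oag M (\<lambda>B. homogeneous M E \<xi> \<eta> (B 0)) (\<lambda>B. homogeneous real_struc E \<xi> \<eta> (B 0))"
  unfolding homogeneous_def
  apply (rule fo_all[where b = 1], rule fo_all[where b = 2], rule fo_all[where b = 3], rule fo_all[where b = 4])
         apply (intro fo_imp fo_conj fo_cellX fo_cellY fo_exact fo_agree fo_ball fo_iff fo_rel
      fo_belowX fo_belowY finite_K assms)
                apply simp_all
  done

lemma fo_dichotomy:
  assumes "E \<subseteq> K"
  shows "fo oag M (\<lambda>B. dichotomy M E \<xi> \<eta> (B 0)) (\<lambda>B. dichotomy real_struc E \<xi> \<eta> (B 0))"
  unfolding dichotomy_def
  by (intro fo_imp fo_ball fo_conj fo_not fo_wit fo_homogeneous finite_K assms)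

end

section \<open>The dichotomy over the reals\<close>

lemma rv_lipschitz: "\<exists>B\<ge>0. \<forall>e e' d. (\<forall>v. \<bar>e v - e' v\<bar> \<le> d) \<longrightarrow> \<bar>rv e t - rv e' t\<bar> \<le> B * d"
proof (induction t)
  case (Var i)
  show ?case by (intro exI[of _ 1]) simp
next
  case (Par a)
  show ?case by (intro exI[of _ 0]) simp
next
  case Zero
  show ?case by (intro exI[of _ 0]) simp
next
  case (Add s t)
  then obtain A B where *: "A \<ge> 0" "\<forall>e e' d. (\<forall>v. \<bar>e v - e' v\<bar> \<le> d) \<longrightarrow> \<bar>rv e s - rv e' s\<bar> \<le> A * d"
    "B \<ge> 0" "\<forall>e e' d. (\<forall>v. \<bar>e v - e' v\<bar> \<le> d) \<longrightarrow> \<bar>rv e t - rv e' t\<bar> \<le> B * d" by blast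
  have "\<bar>rv e (Add s t) - rv e' (Add s t)\<bar> \<le> (A + B) * d" if "\<forall>v. \<bar>e v - e' v\<bar> \<le> d" for e e' d
  proof -
    have "\<bar>rv e s - rv e' s\<bar> \<le> A * d" "\<bar>rv e t - rv e' t\<bar> \<le> B * d" using * that by blast+
    then show ?thesis by (simp add: algebra_simps)
  qed
  then show ?case using *(1,3) by (intro exI[of _ "A + B"]) auto
next
  case (Neg t)
  then show ?case by (simp add: abs_minus_commute)
qed

text \<open>Both a strict inequality and its negation survive convex combinations, which makes the
  cells convex.\<close>

lemma less_mix:
  fixes s t s' t' r :: real
  assumes "(s < t) = b" "(s' < t') = b" "0 \<le> r" "r \<le> 1"
  shows "((1 - r) * s + r * s' < (1 - r) * t + r * t') = b"
proof (cases b)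
  case True
  then have "s < t" "s' < t'" using assms by auto
  show ?thesis
  proof (cases "r = 0")
    case False
    then have "r * s' < r * t'" using assms \<open>s' < t'\<close> by simp
    moreover have "(1 - r) * s \<le> (1 - r) * t" using assms \<open>s < t\<close> by (simp add: mult_left_mono)
    ultimately show ?thesis using True by linarith
  qed (use True \<open>s < t\<close> in simp)
next
  case False
  then have "(1 - r) * t \<le> (1 - r) * s" "r * t' \<le> r * s'" using assms by (auto intro!: mult_left_mono)
  then show ?thesis using False by linarith
qed

lemma eventually_small: "eventually (\<lambda>r. r * \<bar>a\<bar> < d) (at_right (0::real))" if "d > 0"
proof -
  have "((\<lambda>r. r * \<bar>a\<bar>) \<longlongrightarrow> 0 * \<bar>a\<bar>) (at_right 0)" by (intro tendsto_intros)
  then show ?thesis using that by (auto dest: order_tendstoD(2))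
qed

text \<open>The value moves at the constant rate \<open>v2 - v1\<close>, so a value close to the one
  at time \<open>t\<close> is taken at a time close to \<open>t\<close>. This is how
  \<open>p\<close> and \<open>q\<close> come to fill an interval.\<close>

lemma segment_hits:
  fixes t \<rho> v1 v2 w :: real
  assumes "v1 \<noteq> v2" "\<bar>w - ((1 - t) * v1 + t * v2)\<bar> < \<rho> * \<bar>v2 - v1\<bar>"
  obtains s where "\<bar>s - t\<bar> < \<rho>" "(1 - s) * v1 + s * v2 = w"
proof
  let ?d = "(w - ((1 - t) * v1 + t * v2)) / (v2 - v1)"
  show "\<bar>t + ?d - t\<bar> < \<rho>" using assms by (simp add: abs_divide pos_divide_less_eq)
  have "?d * (v2 - v1) = w - ((1 - t) * v1 + t * v2)" using assms by simp
  moreover have "(1 - (t + ?d)) * v1 + (t + ?d) * v2 = (1 - t) * v1 + t * v2 + ?d * (v2 - v1)"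
    by (simp only: algebra_simps)
  ultimately show "(1 - (t + ?d)) * v1 + (t + ?d) * v2 = w" by simp
qed

definition mixf :: "real \<Rightarrow> (nat \<Rightarrow> real) \<Rightarrow> (nat \<Rightarrow> real) \<Rightarrow> nat \<Rightarrow> real" where
  "mixf r x x' i = (1 - r) * x i + r * x' i"

definition mixp where
  "mixp r z z' = (mixf r (fst z) (fst z'), mixf r (snd z) (snd z'))"

context separated
begin

text \<open>What quantifier elimination has to deliver once the variables are separated: for every
  choice of parameters, the cells of \<open>x\<close> and of \<open>y\<close> and the side of each
  wall decide the relation.\<close>

definition determined :: bool where
  "determined \<longleftrightarrow> (\<forall>c x x' y y'.
    (\<forall>a\<in>PX. (xv real_struc c x (fst a) < xv real_struc c x (snd a)) = (xv real_struc c x' (fst a) < xv real_struc c x' (snd a))) \<longrightarrow>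
    (\<forall>a\<in>PY. (yv real_struc c y (fst a) < yv real_struc c y (snd a)) = (yv real_struc c y' (fst a) < yv real_struc c y' (snd a))) \<longrightarrow>
    (\<forall>k\<in>K. sgn (xv real_struc c x (fst k) - yv real_struc c y (snd k)) = sgn (xv real_struc c x' (fst k) - yv real_struc c y' (snd k))) \<longrightarrow>
    rel real_struc c x y = rel real_struc c x' y')"

lemma xv_mix: "xv real_struc c (mixf r x x') t = (1 - r) * xv real_struc c x t + r * xv real_struc c x' t"
  unfolding xv_def rv_affine[symmetric]
  by (rule tv_cong) (auto simp: comb_def mixf_def algebra_simps)

lemma yv_mix: "yv real_struc c (mixf r y y') t = (1 - r) * yv real_struc c y t + r * yv real_struc c y' t"
  unfolding yv_def rv_affine[symmetric]
  by (rule tv_cong) (auto simp: comb_def mixf_def algebra_simps)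

lemma xv_lipschitz:
  "\<exists>B\<ge>0. \<forall>x x' d. 0 \<le> d \<longrightarrow> (\<forall>i<m. \<bar>x i - x' i\<bar> \<le> d) \<longrightarrow> \<bar>xv real_struc c x t - xv real_struc c x' t\<bar> \<le> B * d"
proof -
  obtain B where B: "B \<ge> 0" "\<And>e e' d. (\<forall>v. \<bar>e v - e' v\<bar> \<le> d) \<Longrightarrow> \<bar>rv e t - rv e' t\<bar> \<le> B * d"
    using rv_lipschitz by blast
  show ?thesis unfolding xv_def
    by (intro exI[of _ B] conjI allI impI B) (auto simp: comb_def)
qed

lemma yv_lipschitz:
  "\<exists>B\<ge>0. \<forall>y y' d. 0 \<le> d \<longrightarrow> (\<forall>i<n. \<bar>y i - y' i\<bar> \<le> d) \<longrightarrow> \<bar>yv real_struc c y t - yv real_struc c y' t\<bar> \<le> B * d"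
proof -
  obtain B where B: "B \<ge> 0" "\<And>e e' d. (\<forall>v. \<bar>e v - e' v\<bar> \<le> d) \<Longrightarrow> \<bar>rv e t - rv e' t\<bar> \<le> B * d"
    using rv_lipschitz by blast
  show ?thesis unfolding yv_def
    by (intro exI[of _ B] conjI allI impI B) (auto simp: comb_def)
qed

definition wall_fun where
  "wall_fun c k z = xv real_struc c (fst z) (fst k) - yv real_struc c (snd z) (snd k)"

text \<open>With Lipschitz constants \<open>A\<close> and \<open>B\<close> of the two sides, a
  perturbation below \<open>d\<close> changes the wall function by at most
  \<open>(A + B) * d\<close>. The sign survives if this is less than the absolute value at
  \<open>z0\<close>.\<close>

lemma wall_sign_stable:
  assumes "finite L" "\<And>l. l \<in> L \<Longrightarrow> wall_fun c l z0 \<noteq> 0"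
  obtains d where "d > 0" "\<And>x y l. (\<forall>i<m. \<bar>x i - fst z0 i\<bar> < d) \<Longrightarrow> (\<forall>i<n. \<bar>y i - snd z0 i\<bar> < d)
    \<Longrightarrow> l \<in> L \<Longrightarrow> sgn (wall_fun c l (x, y)) = sgn (wall_fun c l z0)"
proof -
  define good where "good l d \<longleftrightarrow> (\<forall>x y. (\<forall>i<m. \<bar>x i - fst z0 i\<bar> < d) \<longrightarrow> (\<forall>i<n. \<bar>y i - snd z0 i\<bar> < d)
    \<longrightarrow> sgn (wall_fun c l (x, y)) = sgn (wall_fun c l z0))" for l d
  have "eventually (\<lambda>d. good l d) (at_right 0)" if l: "l \<in> L" for l
  proof -
    obtain A where A: "A \<ge> 0" "\<And>x x' d. 0 \<le> d \<Longrightarrow> (\<forall>i<m. \<bar>x i - x' i\<bar> \<le> d) \<Longrightarrow>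
        \<bar>xv real_struc c x (fst l) - xv real_struc c x' (fst l)\<bar> \<le> A * d"
      using xv_lipschitz by blast
    obtain B where B: "B \<ge> 0" "\<And>x x' d. 0 \<le> d \<Longrightarrow> (\<forall>i<n. \<bar>x i - x' i\<bar> \<le> d) \<Longrightarrow>
        \<bar>yv real_struc c x (snd l) - yv real_struc c x' (snd l)\<bar> \<le> B * d"
      using yv_lipschitz by blast
    have ev: "eventually (\<lambda>d. 0 < d \<and> d * \<bar>A + B\<bar> < \<bar>wall_fun c l z0\<bar>) (at_right 0)"
      using assms(2)[OF l] by (intro eventually_conj eventually_small) (auto simp: eventually_at_right_less)
    have "good l d" if d: "0 < d" "d * \<bar>A + B\<bar> < \<bar>wall_fun c l z0\<bar>" for d
      unfolding good_def
    proof (intro allI impI)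
      fix x y assume x: "\<forall>i<m. \<bar>x i - fst z0 i\<bar> < d" and y: "\<forall>i<n. \<bar>y i - snd z0 i\<bar> < d"
      have "\<bar>xv real_struc c x (fst l) - xv real_struc c (fst z0) (fst l)\<bar> \<le> A * d"
        "\<bar>yv real_struc c y (snd l) - yv real_struc c (snd z0) (snd l)\<bar> \<le> B * d"
        using A(2)[of d x "fst z0"] B(2)[of d y "snd z0"] x y d(1) by (simp_all add: less_imp_le)
      moreover have "A * d + B * d < \<bar>wall_fun c l z0\<bar>" using d(2) A(1) B(1) by (simp add: algebra_simps)
      ultimately have "\<bar>wall_fun c l (x, y) - wall_fun c l z0\<bar> < \<bar>wall_fun c l z0\<bar>"
        by (simp add: wall_fun_def)
      then show "sgn (wall_fun c l (x, y)) = sgn (wall_fun c l z0)" by (auto simp: sgn_if split: if_splits)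
    qed
    with ev show ?thesis by (auto elim: eventually_mono)
  qed
  then have "eventually (\<lambda>d. \<forall>l\<in>L. good l d) (at_right 0)"
    using assms(1) by (intro eventually_ball_finite) auto
  then have "eventually (\<lambda>d. 0 < d \<and> (\<forall>l\<in>L. good l d)) (at_right 0)"
    by (intro eventually_conj) (auto simp: eventually_at_right_less)
  then obtain d where "0 < d" "\<forall>l\<in>L. good l d"
    using eventually_happens'[OF trivial_limit_at_right_real] by blast
  then show ?thesis using that[of d] unfolding good_def by blast
qed

text \<open>Two pairs that violate homogeneity lie in one convex product of fibres. Walls with a
  constant side do not separate them, so \<open>D\<close> changes across some wall both of whose
  sides vary. Close to a crossing of this wall only, both sides fill an interval and the relation
  depends on the side alone, which is the excluded witness.\<close>

lemma real_dichotomy: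
  assumes "determined" "E \<subseteq> K"
  shows "dichotomy real_struc E \<xi> \<eta> c"
  unfolding dichotomy_def homogeneous_def
proof (intro impI allI, elim conjE, rule ccontr)
  fix a b a' b'
  let ?p = "\<lambda>k z. xv real_struc c (fst z) (fst k)" and ?q = "\<lambda>k z. yv real_struc c (snd z) (snd k)"
  let ?f = "wall_fun c" and ?D = "\<lambda>z. rel real_struc c (fst z) (snd z)"
  assume nowit: "\<forall>k\<in>K. \<not> wit real_struc E \<xi> \<eta> k True c \<and> \<not> wit real_struc E \<xi> \<eta> k False c"
    and cells: "cellX real_struc \<xi> c a" "cellX real_struc \<xi> c a'" "cellY real_struc \<eta> c b" "cellY real_struc \<eta> c b'"
    and ex: "exact real_struc E c a b" "exact real_struc E c a' b'" and ag: "agree real_struc E c a b'"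
    and belX: "\<forall>k\<in>K. belowX real_struc E \<eta> c a k = belowX real_struc E \<eta> c a' k"
    and belY: "\<forall>k\<in>K. belowY real_struc E \<xi> c b k = belowY real_struc E \<xi> c b' k"
    and neq: "rel real_struc c a b \<noteq> rel real_struc c a' b'"
  \<comment> \<open>For walls in \<open>E\<close>, points of \<open>X\<close> have the value
    \<open>p(x) = q(b)\<close> and points of \<open>Y\<close> the value \<open>q(y) = p(a)\<close>.
    As \<open>p(a) = q(b)\<close>, every pair in \<open>X \<times> Y\<close> lies on all walls of
    \<open>E\<close>.\<close>
  define X where "X = {x. cellX real_struc \<xi> c x \<and> agree real_struc E c x b}"
  define Y where "Y = {y. cellY real_struc \<eta> c y \<and> agree real_struc E c a y}"
  have onw: "onwall real_struc k c a b" "onwall real_struc k c a' b'" "onwall real_struc k c a b'" if "k \<in> E" for k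
    using that ex ag assms(2) by (auto simp: exact_def agree_def)
  have agX: "agree real_struc E c x y \<longleftrightarrow> agree real_struc E c x b" if "y \<in> Y" for x y
    using that onw by (auto simp: Y_def agree_def onwall_def)
  have agY: "agree real_struc E c x y \<longleftrightarrow> agree real_struc E c a y" if "x \<in> X" for x y
    using that onw by (auto simp: X_def agree_def onwall_def)
  have aX: "a \<in> X" and a'X: "a' \<in> X" and bY: "b \<in> Y" and b'Y: "b' \<in> Y"
    using cells onw by (auto simp: X_def Y_def agree_def onwall_def)
  have Xmix: "mixf r x x' \<in> X" if "x \<in> X" "x' \<in> X" "0 \<le> r" "r \<le> 1" for x x' r
  proof -
    have "cellX real_struc \<xi> c (mixf r x x')"
      unfolding cellX_def real_struc_simps xv_mix
      by (intro ballI less_mix) (use that in \<open>simp_all add: X_def cellX_def\<close>)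
    moreover have "agree real_struc E c (mixf r x x') b"
      using that by (auto simp: X_def agree_def onwall_def xv_mix algebra_simps)
    ultimately show ?thesis by (simp add: X_def)
  qed
  have Ymix: "mixf r y y' \<in> Y" if "y \<in> Y" "y' \<in> Y" "0 \<le> r" "r \<le> 1" for y y' r
  proof -
    have "cellY real_struc \<eta> c (mixf r y y')"
      unfolding cellY_def real_struc_simps yv_mix
      by (intro ballI less_mix) (use that in \<open>simp_all add: Y_def cellY_def\<close>)
    moreover have "agree real_struc E c a (mixf r y y')"
      using that by (auto simp: Y_def agree_def onwall_def yv_mix algebra_simps)
    ultimately show ?thesis by (simp add: Y_def)
  qed
  interpret convex_region mixp "X \<times> Y"
    by unfold_locales (auto simp: mixp_def intro: Xmix Ymix)
  have affp: "affine (?p k)" and affq: "affine (?q k)" for k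
    by (auto simp: affine_def mixp_def xv_mix yv_mix)
  have afff: "affine (?f k)" for k
    using affine_comb[OF affp affq, of 1 k 1 k] by (simp add: wall_fun_def[abs_def])
  let ?K0 = "K - E"
  define K' where "K' = {k\<in>?K0. (\<exists>u\<in>X \<times> Y. \<exists>v\<in>X \<times> Y. ?p k u \<noteq> ?p k v) \<and> (\<exists>u\<in>X \<times> Y. \<exists>v\<in>X \<times> Y. ?q k u \<noteq> ?q k v)}"
  have detD: "?D z = ?D z'" if z: "z \<in> X \<times> Y" "z' \<in> X \<times> Y" and s: "\<And>k. k \<in> ?K0 \<Longrightarrow> sgn (?f k z) = sgn (?f k z')"
    for z z'
  proof -
    have "sgn (?f k z) = sgn (?f k z')" if "k \<in> K" for k
    proof (cases "k \<in> E")
      case True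
      have "?f k z = 0" if "z \<in> X \<times> Y" for z
        using that onw(1)[OF True] True by (auto simp: X_def Y_def agree_def onwall_def wall_fun_def)
      then show ?thesis using z by simp
    qed (use s that in blast)
    then have walls: "\<forall>k\<in>K. sgn (?p k z - ?q k z) = sgn (?p k z' - ?q k z')" by (simp add: wall_fun_def)
    have "\<forall>a\<in>PX. (xv real_struc c (fst z) (fst a) < xv real_struc c (fst z) (snd a)) =
        (xv real_struc c (fst z') (fst a) < xv real_struc c (fst z') (snd a))"
      using z by (simp add: X_def cellX_def mem_Times_iff)
    moreover have "\<forall>a\<in>PY. (yv real_struc c (snd z) (fst a) < yv real_struc c (snd z) (snd a)) =
        (yv real_struc c (snd z') (fst a) < yv real_struc c (snd z') (snd a))"
      using z by (simp add: Y_def cellY_def mem_Times_iff)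
    ultimately show ?thesis using assms(1) walls unfolding determined_def by blast
  qed
  have off: "?f k (a, b) \<noteq> 0" "?f k (a', b') \<noteq> 0" if "k \<in> ?K0" for k
    using that ex by (auto simp: exact_def onwall_def wall_fun_def)
  \<comment> \<open>If \<open>p\<close> is constant on \<open>X\<close>, then \<open>belowY\<close>
    merely compares this constant with \<open>q(y)\<close>; its equal truth values at
    \<open>b\<close> and \<open>b'\<close> place both pairs on the same side. The case of constant
    \<open>q\<close> is dual.\<close>
  have same: "sgn (?f k (a, b)) = sgn (?f k (a', b'))" if k: "k \<in> ?K0 - K'" for k
  proof -
    have "(\<forall>x\<in>X. ?p k (x, b) = ?p k (a, b)) \<or> (\<forall>y\<in>Y. ?q k (a, y) = ?q k (a, b))"
    proof (rule ccontr)
      assume "\<not> ?thesis"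
      then obtain x y where xy: "x \<in> X" "?p k (x, b) \<noteq> ?p k (a, b)" "y \<in> Y" "?q k (a, y) \<noteq> ?q k (a, b)"
        by blast
      then have C: "(x, b) \<in> X \<times> Y" "(a, y) \<in> X \<times> Y" "(a, b) \<in> X \<times> Y" using aX bY by auto
      have "\<exists>u\<in>X \<times> Y. \<exists>v\<in>X \<times> Y. ?p k u \<noteq> ?p k v"
        by (intro bexI[of _ "(x, b)"] bexI[of _ "(a, b)"] xy C)
      moreover have "\<exists>u\<in>X \<times> Y. \<exists>v\<in>X \<times> Y. ?q k u \<noteq> ?q k v"
        by (intro bexI[of _ "(a, y)"] bexI[of _ "(a, b)"] xy C)
      moreover have "k \<in> ?K0" using k by (rule DiffD1)
      ultimately have "k \<in> K'" unfolding K'_def mem_Collect_eq by (intro conjI)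
      then show False using k by simp
    qed
    then have "(?f k (a, b) < 0) = (?f k (a', b') < 0)"
    proof
      assume const: "\<forall>x\<in>X. ?p k (x, b) = ?p k (a, b)"
      have *: "belowY real_struc E \<xi> c y k \<longleftrightarrow> ?p k (a, b) < yv real_struc c y (snd k)" if "y \<in> Y" for y
      proof -
        have "belowY real_struc E \<xi> c y k \<longleftrightarrow> (\<forall>x\<in>X. xv real_struc c x (fst k) < yv real_struc c y (snd k))"
          using agX[OF that] by (auto simp: belowY_def below_def X_def)
        also have "\<dots> \<longleftrightarrow> (\<forall>x\<in>X. ?p k (a, b) < yv real_struc c y (snd k))"
          by (intro ball_cong refl) (use const in force)
        finally show ?thesis using aX by blast
      qed
      have "belowY real_struc E \<xi> c b k = belowY real_struc E \<xi> c b' k" using belY k by blast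
      moreover have "?p k (a', b) = ?p k (a, b)" using const a'X by (rule bspec)
      ultimately show ?thesis unfolding *[OF bY] *[OF b'Y] by (simp add: wall_fun_def)
    next
      assume const: "\<forall>y\<in>Y. ?q k (a, y) = ?q k (a, b)"
      have *: "belowX real_struc E \<eta> c x k \<longleftrightarrow> xv real_struc c x (fst k) < ?q k (a, b)" if "x \<in> X" for x
      proof -
        have "belowX real_struc E \<eta> c x k \<longleftrightarrow> (\<forall>y\<in>Y. xv real_struc c x (fst k) < yv real_struc c y (snd k))"
          using agY[OF that] by (auto simp: belowX_def below_def Y_def)
        also have "\<dots> \<longleftrightarrow> (\<forall>y\<in>Y. xv real_struc c x (fst k) < ?q k (a, b))"
          by (intro ball_cong refl) (use const in force)
        finally show ?thesis using bY by blast
      qed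
      have "belowX real_struc E \<eta> c a k = belowX real_struc E \<eta> c a' k" using belX k by blast
      moreover have "?q k (a, b') = ?q k (a, b)" using const b'Y by (rule bspec)
      ultimately show ?thesis unfolding *[OF aX] *[OF a'X] by (simp add: wall_fun_def)
    qed
    then show ?thesis using off[of k] k by (auto simp: sgn_if)
  qed
  have "\<exists>z\<in>X \<times> Y. \<exists>w\<in>X \<times> Y. \<exists>k\<in>K'. ?D z \<noteq> ?D w \<and> sgn (?f k z) \<noteq> sgn (?f k w) \<and> ?p k z \<noteq> ?p k w \<and> ?q k z \<noteq> ?q k w
    \<and> (\<forall>l\<in>?K0. ?f l z \<noteq> 0 \<and> ?f l w \<noteq> 0 \<and> (sgn (?f l z) = sgn (?f l w) \<or> (\<exists>c. \<forall>u\<in>X \<times> Y. ?f l u = c * ?f k u)))"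
  proof (rule single_wall_crossing[where ?z1.0 = "(a, b)" and ?z2.0 = "(a', b')" and K = ?K0
        and D = ?D and f = ?f and p = ?p and q = ?q])
    show "finite ?K0" using finite_K by simp
    show "K' \<subseteq> ?K0" by (auto simp: K'_def)
    show "?D z = ?D z'" if "z \<in> X \<times> Y" "z' \<in> X \<times> Y" "\<And>k. k \<in> ?K0 \<Longrightarrow> sgn (?f k z) = sgn (?f k z')" for z z'
      using that by (rule detD)
    show "\<exists>u\<in>X \<times> Y. \<exists>v\<in>X \<times> Y. ?p k u \<noteq> ?p k v" "\<exists>u\<in>X \<times> Y. \<exists>v\<in>X \<times> Y. ?q k u \<noteq> ?q k v" if "k \<in> K'" for k
      using that unfolding K'_def mem_Collect_eq by blast+
    show "?D (a, b) \<noteq> ?D (a', b')" using neq by simp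
    show "(a, b) \<in> X \<times> Y" "(a', b') \<in> X \<times> Y" using aX bY a'X b'Y by simp_all
  qed (erule off same | rule affp affq afff)+
  then obtain z w k where z: "z \<in> X \<times> Y" and w: "w \<in> X \<times> Y" and k: "k \<in> K'" and Dzw: "?D z \<noteq> ?D w"
    and sk: "sgn (?f k z) \<noteq> sgn (?f k w)" and pk: "?p k z \<noteq> ?p k w" and qk: "?q k z \<noteq> ?q k w"
    and others: "\<And>l. l \<in> ?K0 \<Longrightarrow> ?f l z \<noteq> 0 \<and> ?f l w \<noteq> 0 \<and> (sgn (?f l z) = sgn (?f l w) \<or> (\<exists>c. \<forall>u\<in>X \<times> Y. ?f l u = c * ?f k u))"
    by blast
  have kK: "k \<in> ?K0" using k by (simp add: K'_def)
  \<comment> \<open>The time at which the segment from \<open>z\<close> to \<open>w\<close> meets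
    the wall \<open>k\<close>, so that \<open>z0\<close> lies on it.\<close>
  define t where "t = ?f k z / (?f k z - ?f k w)"
  have opp: "(?f k z < 0 \<and> 0 < ?f k w) \<or> (?f k w < 0 \<and> 0 < ?f k z)"
    using sk others[OF kK] by (auto simp: sgn_if split: if_splits)
  then have t: "0 < t" "t < 1" and tne: "?f k z - ?f k w \<noteq> 0" by (auto simp: t_def field_simps)
  define z0 where "z0 = mixp t z w"
  have z0C: "z0 \<in> X \<times> Y" unfolding z0_def using mix_in z w t by simp
  have fz0: "?f l z0 = (1 - t) * ?f l z + t * ?f l w" for l
    using afff unfolding affine_def z0_def by blast
  have "t * (?f k z - ?f k w) = ?f k z" using tne by (simp add: t_def)
  then have fk0: "?f k z0 = 0" unfolding fz0 by (simp add: algebra_simps)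
  \<comment> \<open>These walls do not separate \<open>z\<close> from \<open>w\<close>, so
    \<open>z0\<close> is off them on the same side, and so are all nearby points. Every other wall
    outside \<open>E\<close> is a multiple of \<open>k\<close>, so near \<open>z0\<close> the side
    of \<open>k\<close> decides everything.\<close>
  define L where "L = {l\<in>?K0. sgn (?f l z) = sgn (?f l w)}"
  have sL: "sgn (?f l z0) = sgn (?f l z)" if "l \<in> L" for l
  proof -
    have l: "?f l z \<noteq> 0" "?f l w \<noteq> 0" "sgn (?f l z) = sgn (?f l w)" using that others by (auto simp: L_def)
    then consider "?f l z > 0" "?f l w > 0" | "?f l z < 0" "?f l w < 0" by (auto simp: sgn_if split: if_splits)
    then show ?thesis
    proof cases
      case 1
      then have "(1 - t) * ?f l z > 0" "t * ?f l w > 0" using t by simp_all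
      then show ?thesis unfolding fz0 using 1 by simp
    next
      case 2
      then have "(1 - t) * ?f l z < 0" "t * ?f l w < 0" using t by (simp_all add: mult_pos_neg)
      then show ?thesis unfolding fz0 using 2 by simp
    qed
  qed
  have finL: "finite L" using finite_K by (simp add: L_def)
  have offL: "?f l z0 \<noteq> 0" if "l \<in> L" for l using sL[OF that] others[of l] that by (auto simp: L_def sgn_if split: if_splits)
  obtain d where d: "d > 0" and dL: "\<And>x y l. (\<forall>i<m. \<bar>x i - fst z0 i\<bar> < d) \<Longrightarrow>
      (\<forall>i<n. \<bar>y i - snd z0 i\<bar> < d) \<Longrightarrow> l \<in> L \<Longrightarrow> sgn (?f l (x, y)) = sgn (?f l z0)"
    using wall_sign_stable[where c = c, OF finL offL] by blast
  have local: "?D (x, y) = ?D v"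
    if v: "v = z \<or> v = w" and xy: "x \<in> X" "y \<in> Y" "\<forall>i<m. \<bar>x i - fst z0 i\<bar> < d" "\<forall>i<n. \<bar>y i - snd z0 i\<bar> < d"
      and sg: "sgn (?f k (x, y)) = sgn (?f k v)" for x y v
  proof (rule detD)
    show "(x, y) \<in> X \<times> Y" "v \<in> X \<times> Y" using xy v z w by auto
    fix l assume l: "l \<in> ?K0"
    show "sgn (?f l (x, y)) = sgn (?f l v)"
    proof (cases "l \<in> L")
      case True
      then show ?thesis using dL[OF xy(3,4) True] sL[OF True] v by (auto simp: L_def)
    next
      case False
      then obtain r where "\<forall>u\<in>X \<times> Y. ?f l u = r * ?f k u" using others[OF l] l by (auto simp: L_def)
      then have "?f l (x, y) = r * ?f k (x, y)" "?f l v = r * ?f k v" using xy v z w by auto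
      then show ?thesis using sg by (simp add: sgn_mult)
    qed
  qed
  define \<tau> where "\<tau> = ?p k z0"
  have \<tau>q: "?q k z0 = \<tau>" using fk0 by (simp add: \<tau>_def wall_fun_def)
  \<comment> \<open>For times within \<open>\<rho>\<close> of \<open>t\<close> the mixture stays
    between \<open>z\<close> and \<open>w\<close> and inside the box of radius
    \<open>d\<close>.\<close>
  have "eventually (\<lambda>r. r * 1 < t \<and> r * 1 < 1 - t \<and> (\<forall>i\<in>{..<m}. r * \<bar>fst w i - fst z i\<bar> < d) \<and>
      (\<forall>i\<in>{..<n}. r * \<bar>snd w i - snd z i\<bar> < d) \<and> 0 < r) (at_right 0)"
    using eventually_small[of t 1] eventually_small[of "1 - t" 1] t d
    by (intro eventually_conj eventually_ball_finite ballI eventually_small) (auto simp: eventually_at_right_less)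
  then obtain \<rho> where \<rho>: "0 < \<rho>" "\<rho> < t" "\<rho> < 1 - t" "\<And>i. i < m \<Longrightarrow> \<rho> * \<bar>fst w i - fst z i\<bar> < d"
    "\<And>i. i < n \<Longrightarrow> \<rho> * \<bar>snd w i - snd z i\<bar> < d"
    using eventually_happens'[OF trivial_limit_at_right_real] by fastforce
  \<comment> \<open>Times within \<open>\<rho>\<close> of \<open>t\<close> let \<open>p\<close> and
    \<open>q\<close> each range over an interval around the common value \<open>\<tau>\<close>; the
    smaller radius serves both. The times for \<open>x\<close> and for \<open>y\<close> are chosen
    independently.\<close>
  define \<delta> where "\<delta> = min (\<rho> * \<bar>?p k w - ?p k z\<bar>) (\<rho> * \<bar>?q k w - ?q k z\<bar>)"
  have \<delta>: "\<delta> > 0" using \<rho> pk qk by (simp add: \<delta>_def)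
  have close: "\<bar>mixf s u v i - mixf t u v i\<bar> < d" if "\<rho> * \<bar>v i - u i\<bar> < d" "\<bar>s - t\<bar> < \<rho>" for s u v i
  proof -
    have "mixf s u v i - mixf t u v i = (s - t) * (v i - u i)" by (simp add: mixf_def algebra_simps)
    moreover have "\<bar>s - t\<bar> * \<bar>v i - u i\<bar> \<le> \<rho> * \<bar>v i - u i\<bar>" using that by (intro mult_right_mono) auto
    ultimately show ?thesis using that by (simp add: abs_mult)
  qed
  have box: "(\<forall>i\<in>{..<r}. v i - d < u i \<and> u i < v i + d) \<longleftrightarrow> (\<forall>i<r. \<bar>u i - v i\<bar> < d)" for r :: nat and u v :: "nat \<Rightarrow> real"
    by (intro iffI ballI allI impI) (auto simp: abs_less_iff dest!: bspec spec)
  have nearX: "nearX real_struc E \<xi> c b (\<lambda>i. fst z0 i - d) (\<lambda>i. fst z0 i + d) x \<longleftrightarrow>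
      x \<in> X \<and> (\<forall>i<m. \<bar>x i - fst z0 i\<bar> < d)" for x
    by (simp add: nearX_def X_def inbox_def box)
  have nearY: "nearY real_struc E \<eta> c a (\<lambda>i. snd z0 i - d) (\<lambda>i. snd z0 i + d) y \<longleftrightarrow>
      y \<in> Y \<and> (\<forall>i<n. \<bar>y i - snd z0 i\<bar> < d)" for y
    by (simp add: nearY_def Y_def inbox_def box)
  \<comment> \<open>The truth value on the side \<open>p < q\<close>, where the wall function is
    negative.\<close>
  define B where "B = ?D (if ?f k z < 0 then z else w)"
  have "wit real_struc E \<xi> \<eta> k B c"
    unfolding wit_def
  proof (rule exI[of _ a], rule exI[of _ b], rule exI[of _ "\<lambda>i. fst z0 i - d"], rule exI[of _ "\<lambda>i. fst z0 i + d"],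
      rule exI[of _ "\<lambda>i. snd z0 i - d"], rule exI[of _ "\<lambda>i. snd z0 i + d"], rule exI[of _ "\<tau> - \<delta>"],
      rule exI[of _ "\<tau> + \<delta>"], unfold nearX nearY real_struc_simps, intro conjI allI impI)
    show "\<tau> - \<delta> < \<tau> + \<delta>" using \<delta> by simp
  next
    fix v assume "\<tau> - \<delta> < v \<and> v < \<tau> + \<delta>"
    then have v: "\<bar>v - \<tau>\<bar> < \<delta>" by auto
    have "\<tau> = (1 - t) * ?p k z + t * ?p k w" using affp unfolding affine_def \<tau>_def z0_def by blast
    then obtain s where s: "\<bar>s - t\<bar> < \<rho>" "(1 - s) * ?p k z + s * ?p k w = v"
      using segment_hits[OF pk, of v t \<rho>] v by (auto simp: \<delta>_def)
    have "\<bar>mixf s (fst z) (fst w) i - fst z0 i\<bar> < d" if "i < m" for i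
      using close[of "fst w" i "fst z" s] \<rho>(4)[OF that] s(1) by (simp add: z0_def mixp_def)
    moreover have "mixf s (fst z) (fst w) \<in> X" using Xmix z w s(1) \<rho> by auto
    ultimately show "\<exists>x. (x \<in> X \<and> (\<forall>i<m. \<bar>x i - fst z0 i\<bar> < d)) \<and> xv real_struc c x (fst k) = v"
      using s(2) by (intro exI[of _ "mixf s (fst z) (fst w)"]) (simp add: xv_mix)
  next
    fix v assume "\<tau> - \<delta> < v \<and> v < \<tau> + \<delta>"
    then have v: "\<bar>v - \<tau>\<bar> < \<delta>" by auto
    have "\<tau> = (1 - t) * ?q k z + t * ?q k w" using affq unfolding affine_def \<tau>q[symmetric] z0_def by blast
    then obtain s where s: "\<bar>s - t\<bar> < \<rho>" "(1 - s) * ?q k z + s * ?q k w = v"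
      using segment_hits[OF qk, of v t \<rho>] v by (auto simp: \<delta>_def)
    have "\<bar>mixf s (snd z) (snd w) i - snd z0 i\<bar> < d" if "i < n" for i
      using close[of "snd w" i "snd z" s] \<rho>(5)[OF that] s(1) by (simp add: z0_def mixp_def)
    moreover have "mixf s (snd z) (snd w) \<in> Y" using Ymix z w s(1) \<rho> by auto
    ultimately show "\<exists>y. (y \<in> Y \<and> (\<forall>i<n. \<bar>y i - snd z0 i\<bar> < d)) \<and> yv real_struc c y (snd k) = v"
      using s(2) by (intro exI[of _ "mixf s (snd z) (snd w)"]) (simp add: yv_mix)
  next
    fix x y
    assume xy: "(x \<in> X \<and> (\<forall>i<m. \<bar>x i - fst z0 i\<bar> < d)) \<and> (y \<in> Y \<and> (\<forall>i<n. \<bar>y i - snd z0 i\<bar> < d))"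
    {
      assume "below real_struc k c x y"
      then have "?f k (x, y) < 0" by (simp add: below_def wall_fun_def)
      then show "rel real_struc c x y = B"
        using local[of "if ?f k z < 0 then z else w" x y] xy opp by (auto simp: B_def sgn_if split: if_splits)
    next
      assume "above real_struc k c x y"
      then have "0 < ?f k (x, y)" by (simp add: above_def wall_fun_def)
      then show "rel real_struc c x y = (\<not> B)"
        using local[of "if ?f k z < 0 then w else z" x y] xy opp Dzw by (auto simp: B_def sgn_if split: if_splits)
    }
  qed
  then show False using nowit kK by (cases B) auto
qed

end

section \<open>Separating the variables\<close>

lemma rv_add: "(\<And>v. e v = e1 v + e2 v) \<Longrightarrow> rv e t = rv e1 t + rv e2 t"
  by (induction t) auto

text \<open>By additivity, \<open>s - t\<close> is the sum of its part in \<open>x\<close> and its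
  part in the other variables. Bringing the latter to the right turns every comparison
  \<open>s < t\<close> into \<open>p(x) < q(y)\<close>, so no conditions on one tuple alone are left
  over.\<close>

lemma separable_group:
  assumes "pure_fm True \<phi>"
  obtains K where "separated True K {} {} \<phi>" "separated.determined m n K {} {} \<phi>"
proof -
  obtain A where A: "pure_pairs True A"
    and det: "\<And>e e'. same_order A e e' \<Longrightarrow> sat real_struc e \<phi> = sat real_struc e' \<phi>"
    using sat_determined_by_order[OF assms] by metis
  define isX where "isX v \<longleftrightarrow> even v \<and> v div 2 < m" for v
  define \<sigma> \<sigma>' :: "nat \<Rightarrow> unit trm"
    where "\<sigma> v = (if isX v then Var v else Zero)" and "\<sigma>' v = (if isX v then Zero else Var v)" for v
  define wall where "wall a = (subt \<sigma> (Add (fst a) (Neg (snd a))), subt \<sigma>' (Add (snd a) (Neg (fst a))))"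
    for a :: "unit trm \<times> unit trm"
  have set_\<sigma>: "set_trm (subt \<sigma> t) = {}" "set_trm (subt \<sigma>' t) = {}" if "set_trm t = {}" for t
    using that set_subt[of \<sigma> t] set_subt[of \<sigma>' t] by (auto simp: \<sigma>_def \<sigma>'_def split: if_splits)
  have pure: "pure_pairs True (wall ` A)"
    using A by (auto simp: pure_pairs_def pure_trm_def wall_def set_\<sigma>)
  interpret separated True m n "wall ` A" "{}" "{}" \<phi>
    by unfold_locales (use pure assms in \<open>auto simp: pure_pairs_def\<close>)
  have split: "rv (comb m n x y c) t = rv (comb m n x c c) (subt \<sigma> t) + rv (comb m n c y c) (subt \<sigma>' t)" for x y c t
    unfolding rv_subt by (rule rv_add) (auto simp: comb_def \<sigma>_def \<sigma>'_def isX_def)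
  have diff: "xv real_struc c x (fst (wall a)) - yv real_struc c y (snd (wall a)) =
      rv (comb m n x y c) (fst a) - rv (comb m n x y c) (snd a)" for c x y a
    unfolding split[of x y c] by (simp add: wall_def xv_def yv_def)
  have "determined"
    unfolding determined_def rel_def
  proof (intro allI impI det)
    fix c x x' y y'
    assume "\<forall>k\<in>wall ` A. sgn (xv real_struc c x (fst k) - yv real_struc c y (snd k))
      = sgn (xv real_struc c x' (fst k) - yv real_struc c y' (snd k))"
    then have "sgn (rv (comb m n x y c) s - rv (comb m n x y c) t) = sgn (rv (comb m n x' y' c) s - rv (comb m n x' y' c) t)"
      if "(s, t) \<in> A" for s t
      using that diff[of c _ "(s, t)"] by fastforce
    then show "same_order A (comb m n x y c) (comb m n x' y' c)"
      unfolding same_order_def by (force simp: sgn_if split: if_splits)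
  qed
  then show ?thesis using that separated_axioms by blast
qed

text \<open>Without subtraction, a comparison of two entries of the same tuple is no wall and goes
  into \<open>P\<close>. The converse of \<open>A\<close> is included because the entry of
  \<open>x\<close> may stand on either side, whereas a wall always has its \<open>x\<close> term
  first.\<close>

lemma separable_order:
  assumes "pure_fm False \<phi>"
  obtains K P where "separated False K P P \<phi>" "separated.determined m n K P P \<phi>"
proof -
  obtain A where A: "pure_pairs False A"
    and det: "\<And>e e'. same_order A e e' \<Longrightarrow> sat real_struc e \<phi> = sat real_struc e' \<phi>"
    using sat_determined_by_order[OF assms] by metis
  have pure: "pure_pairs False (A \<union> A\<inverse>)" using A by (auto simp: pure_pairs_def)
  interpret separated False m n "A \<union> A\<inverse>" A A \<phi>
    by unfold_locales (use pure A assms in auto)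
  have "determined"
    unfolding determined_def rel_def
  proof (intro allI impI det)
    fix c x x' y y'
    assume X: "\<forall>a\<in>A. (xv real_struc c x (fst a) < xv real_struc c x (snd a)) = (xv real_struc c x' (fst a) < xv real_struc c x' (snd a))"
      and Y: "\<forall>a\<in>A. (yv real_struc c y (fst a) < yv real_struc c y (snd a)) = (yv real_struc c y' (fst a) < yv real_struc c y' (snd a))"
      and W: "\<forall>k\<in>A \<union> A\<inverse>. sgn (xv real_struc c x (fst k) - yv real_struc c y (snd k))
        = sgn (xv real_struc c x' (fst k) - yv real_struc c y' (snd k))"
    have "(rv (comb m n x y c) s < rv (comb m n x y c) t) = (rv (comb m n x' y' c) s < rv (comb m n x' y' c) t)"
      if st: "(s, t) \<in> A" for s t
    proof -
      have var: "\<exists>i. s = Var i" if "pure_trm False s" for s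
        using that by (cases s) (auto simp: pure_trm_def)
      have "pure_trm False s" "pure_trm False t" using A st by (auto simp: pure_pairs_def)
      then obtain i j where ij: "s = Var i" "t = Var j" using var by blast
      define isX isY where "isX v \<longleftrightarrow> even v \<and> v div 2 < m" and "isY v \<longleftrightarrow> even v \<and> m \<le> v div 2 \<and> v div 2 < m + n" for v
      have cX: "comb m n x y c v = comb m n x c c v" if "\<not> isY v" for x y v
        using that by (auto simp: comb_def isY_def)
      have cY: "comb m n x y c v = comb m n c y c v" if "\<not> isX v" for x y v
        using that by (auto simp: comb_def isX_def)
      have XY: "\<not> (isX v \<and> isY v)" for v by (auto simp: isX_def isY_def)
      have x: "(comb m n x c c i < comb m n x c c j) = (comb m n x' c c i < comb m n x' c c j)"
        using X st by (auto simp: ij xv_def)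
      have y: "(comb m n c y c i < comb m n c y c j) = (comb m n c y' c i < comb m n c y' c j)"
        using Y st by (auto simp: ij yv_def)
      have "sgn (comb m n x c c i - comb m n c y c j) = sgn (comb m n x' c c i - comb m n c y' c j)"
        "sgn (comb m n x c c j - comb m n c y c i) = sgn (comb m n x' c c j - comb m n c y' c i)"
        using bspec[OF W, of "(Var i, Var j)"] bspec[OF W, of "(Var j, Var i)"] st
        by (simp_all add: ij xv_def yv_def)
      then have w: "(comb m n x c c i < comb m n c y c j) = (comb m n x' c c i < comb m n c y' c j)"
        "(comb m n c y c i < comb m n x c c j) = (comb m n c y' c i < comb m n x' c c j)"
        by (auto simp: sgn_if split: if_splits)
      \<comment> \<open>A parameter variable is neither in \<open>x\<close> nor in \<open>y\<close>
        and may be read with either tuple, so these four overlapping cases suffice.\<close>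
      consider "\<not> isY i" "\<not> isY j" | "\<not> isX i" "\<not> isX j" | "\<not> isY i" "\<not> isX j" | "\<not> isX i" "\<not> isY j"
        using XY by blast
      then show ?thesis
        unfolding ij tv_simps
      proof cases
        case 1
        show "(comb m n x y c i < comb m n x y c j) = (comb m n x' y' c i < comb m n x' y' c j)"
          using x cX[of i x y] cX[of i x' y'] cX[of j x y] cX[of j x' y'] 1 by simp
      next
        case 2
        show "(comb m n x y c i < comb m n x y c j) = (comb m n x' y' c i < comb m n x' y' c j)"
          using y cY[of i x y] cY[of i x' y'] cY[of j x y] cY[of j x' y'] 2 by simp
      next
        case 3
        show "(comb m n x y c i < comb m n x y c j) = (comb m n x' y' c i < comb m n x' y' c j)"
          using w(1) cX[of i x y] cX[of i x' y'] cY[of j x y] cY[of j x' y'] 3 by simp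
      next
        case 4
        show "(comb m n x y c i < comb m n x y c j) = (comb m n x' y' c i < comb m n x' y' c j)"
          using w(2) cY[of i x y] cY[of i x' y'] cX[of j x y] cX[of j x' y'] 4 by simp
      qed
    qed
    then show "same_order A (comb m n x y c) (comb m n x' y' c)"
      unfolding same_order_def by blast
  qed
  then show ?thesis using that separated_axioms by blast
qed

lemma separable:
  assumes "pure_fm oag \<phi>"
  obtains K PX PY where "separated oag K PX PY \<phi>" "separated.determined m n K PX PY \<phi>"
  using assms separable_group separable_order by (cases oag) metis+

section \<open>Parameters as variables\<close>

text \<open>Doubling the indices frees the odd ones for parameters. Bound variables are doubled too
  and hence stay even, so no quantifier captures a parameter.\<close>

fun dpt :: "('a \<Rightarrow> nat) \<Rightarrow> 'a trm \<Rightarrow> unit trm" where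
  "dpt g (Var i) = Var (2 * i)"
| "dpt g (Par a) = Var (2 * g a + 1)"
| "dpt g Zero = Zero"
| "dpt g (Add s t) = Add (dpt g s) (dpt g t)"
| "dpt g (Neg t) = Neg (dpt g t)"

fun dp :: "('a \<Rightarrow> nat) \<Rightarrow> 'a fm \<Rightarrow> unit fm" where
  "dp g FF = FF"
| "dp g (Eq s t) = Eq (dpt g s) (dpt g t)"
| "dp g (Less s t) = Less (dpt g s) (dpt g t)"
| "dp g (FNot \<phi>) = FNot (dp g \<phi>)"
| "dp g (FConj \<phi> \<psi>) = FConj (dp g \<phi>) (dp g \<psi>)"
| "dp g (FEx k \<phi>) = FEx (2 * k) (dp g \<phi>)"

definition interleave :: "(nat \<Rightarrow> 'b) \<Rightarrow> (nat \<Rightarrow> 'b) \<Rightarrow> nat \<Rightarrow> 'b" where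
  "interleave e c v = (if even v then e (v div 2) else c v)"

lemma tv_dpt:
  assumes "\<And>a. a \<in> set_trm t \<Longrightarrow> c (2 * g a + 1) = a"
  shows "tv M (interleave e c) (dpt g t) = tval M e t"
  using assms by (induction t) (auto simp: interleave_def)

lemma sat_dp:
  assumes "\<And>a. a \<in> set_fm \<phi> \<Longrightarrow> c (2 * g a + 1) = a"
  shows "sat M (interleave e c) (dp g \<phi>) = holds M e \<phi>"
  using assms
proof (induction \<phi> arbitrary: e)
  case (FEx k \<phi>)
  have "(interleave e c)(2 * k := a) = interleave (e(k := a)) c" for a
    by (auto simp: interleave_def fun_eq_iff elim!: evenE)
  then show ?case using FEx by simp
qed (simp_all add: tv_dpt)

lemma pure_dpt: "oag \<or> order_trm t \<Longrightarrow> pure_trm oag (dpt g t)"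
proof -
  have "set_trm (dpt g t) = {}" by (induction t) auto
  moreover have "order_trm t \<Longrightarrow> order_trm (dpt g t)" by (cases t) auto
  ultimately show "oag \<or> order_trm t \<Longrightarrow> ?thesis" by (auto simp: pure_trm_def)
qed

lemma pure_dp: "in_lang oag \<phi> \<Longrightarrow> pure_fm oag (dp g \<phi>)"
  by (induction \<phi>) (auto simp: in_lang_def intro: pure_dpt)

lemma fvt_dpt: "v \<in> fvt (dpt g t) \<Longrightarrow> odd v \<or> v div 2 \<in> fvt t"
  by (induction t) auto

lemma fv_dp: "v \<in> fv (dp g \<phi>) \<Longrightarrow> odd v \<or> v div 2 \<in> fv \<phi>"
  by (induction \<phi>) (auto dest: fvt_dpt)

lemma enumerate_parameters:
  assumes "finite P"
  shows "\<exists>(g :: 'a \<Rightarrow> nat) c. \<forall>a\<in>P. c (2 * g a + 1) = a"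
proof -
  obtain g :: "'a \<Rightarrow> nat" where "inj_on g P" using finite_imp_inj_to_nat_seg[OF assms] by blast
  then show ?thesis by (intro exI[of _ g] exI[of _ "\<lambda>v. inv_into P g (v div 2)"]) auto
qed

lemma comb_interleave:
  assumes "odd v \<or> v div 2 < m + n" "length a = m"
  shows "comb m n (nth a) (nth b) c v = interleave (nth (a @ b)) c v"
  using assms by (auto simp: comb_def interleave_def nth_append)

lemma finite_set_trm: "finite (set_trm t)"
  by (induction t) auto

lemma finite_set_fm: "finite (set_fm \<phi>)"
  by (induction \<phi>) (auto simp: finite_set_trm)

text \<open>Definable sets consist of lists, while the predicates take infinite tuples. Beyond the
  list the entries come from \<open>c\<close>, so a formula can name them as parameters.\<close>

definition pad :: "nat \<Rightarrow> (nat \<Rightarrow> 'a) \<Rightarrow> 'a list \<Rightarrow> nat \<Rightarrow> 'a" where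
  "pad m c a i = (if i < m then a ! i else c i)"

lemma comb_cong:
  assumes "\<And>i. i < m \<Longrightarrow> x i = x' i" "\<And>i. i < n \<Longrightarrow> y i = y' i"
  shows "comb m n x y c = comb m n x' y' c"
  using assms by (auto simp: comb_def fun_eq_iff)

text \<open>Block 1 carries the tuple, so its first \<open>m\<close> entries become variables. Every
  other entry, including block 0 with the parameters of the formula, is a fixed element of
  \<open>M\<close>.\<close>

lemma definable_fo:
  assumes "fo oag M P Q"
  shows "definable oag M m {a. length a = m \<and> P (\<lambda>b. if b = 1 then pad m c a else c)}"
proof -
  from assms obtain \<phi> where \<phi>: "pure_fm oag \<phi>" "P = (\<lambda>B. sat M (flat B) \<phi>)" by (rule foE)
  define \<sigma> where "\<sigma> v = (case prod_decode v of (b, i) \<Rightarrow> if b = 1 \<and> i < m then Var i else Par (c i))" for v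
  let ?\<psi> = "sub \<sigma> (map_fm (\<lambda>_. s_zero M) \<phi>)"
  have "(\<lambda>v. tval M (nth a) (\<sigma> v)) = flat (\<lambda>b. if b = 1 then pad m c a else c)" for a
    by (auto simp: \<sigma>_def flat_def pad_def fun_eq_iff split: prod.splits)
  then have "holds M (nth a) ?\<psi> = P (\<lambda>b. if b = 1 then pad m c a else c)" for a
    by (simp add: holds_sub \<phi>(2) sat_def)
  moreover have "fv ?\<psi> \<subseteq> {..<m}"
    by (rule order_trans[OF fv_sub]) (auto simp: \<sigma>_def split: prod.splits if_splits)
  moreover have "in_lang oag ?\<psi>"
    using \<phi>(1) by (auto simp: pure_fm_def in_lang_def \<sigma>_def split: prod.splits intro!: order_fm_sub)
  ultimately show ?thesis unfolding definable_def by (intro exI[of _ ?\<psi>]) auto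
qed

section \<open>Half graphs from a witness\<close>

text \<open>Transitivity and density are all that the construction of a half graph uses of the
  order, and both are sentences.\<close>

lemma models_T_order:
  fixes M :: "'a struc"
  assumes "models_T oag M"
  shows "s_less M x y \<Longrightarrow> s_less M y z \<Longrightarrow> s_less M x z"
    and "s_less M x y \<Longrightarrow> \<exists>z. s_less M x z \<and> s_less M z y"
proof -
  have "fo oag M (\<lambda>B. s_less M (B 0 0) (B 1 0) \<and> s_less M (B 1 0) (B 2 0) \<longrightarrow> s_less M (B 0 0) (B 2 0))
    (\<lambda>B. s_less real_struc (B 0 0) (B 1 0) \<and> s_less real_struc (B 1 0) (B 2 0) \<longrightarrow> s_less real_struc (B 0 0) (B 2 0))"
    by (intro fo_imp fo_conj fo_entry_less)
  from fo_transfer[OF assms this] have "\<forall>B :: nat \<Rightarrow> nat \<Rightarrow> 'a. s_less M (B 0 0) (B 1 0) \<and> s_less M (B 1 0) (B 2 0) \<longrightarrow> s_less M (B 0 0) (B 2 0)"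
    by (auto intro: less_trans)
  from spec[OF this, of "\<lambda>b _. if b = 0 then x else if b = 1 then y else z"]
  show "s_less M x y \<Longrightarrow> s_less M y z \<Longrightarrow> s_less M x z" by simp
  have "fo oag M (\<lambda>B. s_less M (B 0 0) (B 1 0) \<longrightarrow> (\<exists>z. s_less M (B 0 0) z \<and> s_less M z (B 1 0)))
    (\<lambda>B. s_less real_struc (B 0 0) (B 1 0) \<longrightarrow> (\<exists>z. s_less real_struc (B 0 0) z \<and> s_less real_struc z (B 1 0)))"
    by (intro fo_imp fo_entry_less, rule fo_ex_entry[where b = 2], intro fo_conj fo_entry_less) simp_all
  from fo_transfer[OF assms this] have "\<forall>B :: nat \<Rightarrow> nat \<Rightarrow> 'a. s_less M (B 0 0) (B 1 0) \<longrightarrow> (\<exists>z. s_less M (B 0 0) z \<and> s_less M z (B 1 0))"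
    by (auto intro: dense)
  from spec[OF this, of "\<lambda>b _. if b = 0 then x else y"]
  show "s_less M x y \<Longrightarrow> \<exists>z. s_less M x z \<and> s_less M z y" by simp
qed

lemma dense_chain:
  assumes trans: "\<And>x y z. R x y \<Longrightarrow> R y z \<Longrightarrow> R x z" and dense: "\<And>x y. R x y \<Longrightarrow> \<exists>z. R x z \<and> R z y" and "R g h"
  obtains f :: "nat \<Rightarrow> 'a" where "\<And>i. R g (f i)" "\<And>i. R (f i) h" "\<And>i j. i < j \<Longrightarrow> R (f i) (f j)"
proof -
  have "\<exists>f. \<forall>i. (R g (f i) \<and> R (f i) h) \<and> R (f i) (f (Suc i))"
  proof (rule dependent_nat_choice)
    show "\<exists>x. R g x \<and> R x h" using dense \<open>R g h\<close> by blast
    show "\<exists>y. (R g y \<and> R y h) \<and> R x y" if "R g x \<and> R x h" for x and i :: nat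
      using that dense[of x h] trans by blast
  qed
  then obtain f where f: "\<And>i. R g (f i)" "\<And>i. R (f i) h" "\<And>i. R (f i) (f (Suc i))" by blast
  have "R (f i) (f j)" if "i < j" for i j
    using that by (induction rule: less_Suc_induct) (auto intro: f trans)
  with f show ?thesis using that by blast
qed

context separated
begin

lemma rel_lists: "rel M c (nth (map x [0..<m])) (nth (map y [0..<n])) = rel M c x y"
proof -
  have "comb m n (nth (map x [0..<m])) (nth (map y [0..<n])) c = comb m n x y c"
    by (rule comb_cong) auto
  then show ?thesis by (simp add: rel_def)
qed

text \<open>Along a monotone chain in the interval, \<open>p(x)\<close> takes the members with even
  index and \<open>q(y)\<close> those with odd index. As \<open>2 * i < 2 * j + 1\<close> exactly if
  \<open>i \<le> j\<close>, the order between the two is a half graph.\<close>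

lemma wit_unstable:
  fixes M :: "'a struc"
  assumes M: "models_T oag M" and wit: "wit M E \<xi> \<eta> k b c"
    and D: "\<And>as bs. length as = m \<Longrightarrow> length bs = n \<Longrightarrow> (as, bs) \<in> D \<longleftrightarrow> rel M c (nth as) (nth bs)"
  shows "unstable m n D"
proof -
  obtain x0 y0 l u l' u' g h where gh: "s_less M g h"
    and X: "\<And>w. s_less M g w \<Longrightarrow> s_less M w h \<Longrightarrow> \<exists>x. nearX M E \<xi> c y0 l u x \<and> xv M c x (fst k) = w"
    and Y: "\<And>w. s_less M g w \<Longrightarrow> s_less M w h \<Longrightarrow> \<exists>y. nearY M E \<eta> c x0 l' u' y \<and> yv M c y (snd k) = w"
    and XY: "\<And>x y. nearX M E \<xi> c y0 l u x \<Longrightarrow> nearY M E \<eta> c x0 l' u' y \<Longrightarrow>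
      (below M k c x y \<longrightarrow> rel M c x y = b) \<and> (above M k c x y \<longrightarrow> rel M c x y = (\<not> b))"
    using wit unfolding wit_def by blast
  \<comment> \<open>If the relation holds on the side \<open>p > q\<close> instead, the chain has to
    descend; \<open>R\<close> treats both cases at once.\<close>
  define R where "R p q = (if b then s_less M p q else s_less M q p)" for p q
  have trans: "R p q \<Longrightarrow> R q r \<Longrightarrow> R p r" for p q r
    using models_T_order(1)[OF M] unfolding R_def by (cases b) auto
  have dense: "R p q \<Longrightarrow> \<exists>r. R p r \<and> R r q" for p q
    using models_T_order(2)[OF M] unfolding R_def by (cases b) auto
  obtain f :: "nat \<Rightarrow> 'a" where f: "\<And>i. s_less M g (f i)" "\<And>i. s_less M (f i) h" "\<And>i j. i < j \<Longrightarrow> R (f i) (f j)"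
  proof (cases b)
    case True
    then have "R g h" using gh by (simp add: R_def)
    obtain f :: "nat \<Rightarrow> 'a" where f: "\<And>i. R g (f i)" "\<And>i. R (f i) h" "\<And>i j. i < j \<Longrightarrow> R (f i) (f j)"
    proof (rule dense_chain[of R g h])
      show "R x z" if "R x y" "R y z" for x y z using that by (rule trans)
      show "\<exists>z. R x z \<and> R z y" if "R x y" for x y using that by (rule dense)
      show "R g h" by fact
    qed blast
    show ?thesis by (rule that[of f]) (use f True in \<open>simp_all add: R_def\<close>)
  next
    case False
    then have "R h g" using gh by (simp add: R_def)
    obtain f :: "nat \<Rightarrow> 'a" where f: "\<And>i. R h (f i)" "\<And>i. R (f i) g" "\<And>i j. i < j \<Longrightarrow> R (f i) (f j)"
    proof (rule dense_chain[of R h g])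
      show "R x z" if "R x y" "R y z" for x y z using that by (rule trans)
      show "\<exists>z. R x z \<and> R z y" if "R x y" for x y using that by (rule dense)
      show "R h g" by fact
    qed blast
    show ?thesis by (rule that[of f]) (use f False in \<open>simp_all add: R_def\<close>)
  qed
  have "\<forall>i. \<exists>x. nearX M E \<xi> c y0 l u x \<and> xv M c x (fst k) = f (2 * i)" using X f(1,2) by blast
  from choice[OF this] obtain x where
    x: "\<forall>i. nearX M E \<xi> c y0 l u (x i) \<and> xv M c (x i) (fst k) = f (2 * i)" ..
  have "\<forall>j. \<exists>y. nearY M E \<eta> c x0 l' u' y \<and> yv M c y (snd k) = f (2 * j + 1)" using Y f(1,2) by blast
  from choice[OF this] obtain y where
    y: "\<forall>j. nearY M E \<eta> c x0 l' u' (y j) \<and> yv M c (y j) (snd k) = f (2 * j + 1)" ..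
  have "rel M c (x i) (y j) \<longleftrightarrow> i \<le> j" for i j
  proof (cases "i \<le> j")
    case True
    then have "R (f (2 * i)) (f (2 * j + 1))" by (intro f) auto
    then show ?thesis using True XY[of "x i" "y j"] x y
      by (auto simp: R_def below_def above_def split: if_splits)
  next
    case False
    then have "R (f (2 * j + 1)) (f (2 * i))" by (intro f) auto
    then show ?thesis using False XY[of "x i" "y j"] x y
      by (auto simp: R_def below_def above_def split: if_splits)
  qed
  then show ?thesis unfolding unstable_def
    by (intro exI[of _ "\<lambda>i. map (x i) [0..<m]"] exI[of _ "\<lambda>j. map (y j) [0..<n]"])
      (simp add: D rel_lists)
qed

lemma exact_definable:
  assumes "models_T oag M"
  shows "eq_definable2 oag M m n {(a, b). length a = m \<and> length b = n \<and> exact M E c (pad m c a) (pad n c b)}"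
proof -
  define \<sigma> where "\<sigma> v = (if odd v \<or> m + n \<le> v div 2 then Par (c v)
    else if v div 2 < m then Var (v div 2) else Par (c (v div 2 - m)))" for v
  \<comment> \<open>An entry of \<open>y\<close> is variable \<open>v div 2\<close> without
    subtracting \<open>m\<close>, because the formula is evaluated at the concatenation
    \<open>a @ b\<close>.\<close>
  define \<tau> where "\<tau> v = (if odd v \<or> m + n \<le> v div 2 then Par (c v)
    else if v div 2 < m then Par (c (v div 2)) else Var (v div 2))" for v
  let ?z = "map_trm (\<lambda>_. s_zero M) :: unit trm \<Rightarrow> 'a trm"
  define W where "W k = Eq (subt \<sigma> (?z (fst k))) (subt \<tau> (?z (snd k)))" for k
  have sub: "tval M (nth (a @ b)) (subt \<rho> t) = tval M (\<lambda>v. tval M (nth (a @ b)) (\<rho> v)) t" for a b \<rho> t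
    using tval_subt[of M _ id] by (simp add: trm.map_id0)
  have W: "holds M (nth (a @ b)) (W k) = onwall M k c (pad m c a) (pad n c b)" if "length a = m" for a b k
  proof -
    have "(\<lambda>v. tval M (nth (a @ b)) (\<sigma> v)) = comb m n (pad m c a) c c"
      "(\<lambda>v. tval M (nth (a @ b)) (\<tau> v)) = comb m n c (pad n c b) c"
      using that by (auto simp: \<sigma>_def \<tau>_def comb_def pad_def nth_append fun_eq_iff)
    then show ?thesis by (simp add: W_def sub onwall_def xv_def yv_def tv_def)
  qed
  have order: "order_trm (\<sigma> v)" "order_trm (\<tau> v)" for v by (auto simp: \<sigma>_def \<tau>_def)
  have fvW: "fv (W k) \<subseteq> {..<m + n}" for k
    by (auto simp: W_def fvt_subt \<sigma>_def \<tau>_def split: if_splits)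
  have langW: "in_lang oag (W k)" if "k \<in> K" for k
    using pure_K[OF that] by (auto simp: W_def in_lang_def pure_trm_def order intro!: order_trm_subt)
  have "\<exists>\<psi>. in_lang oag \<psi> \<and> equational_fm \<psi> \<and> fv \<psi> \<subseteq> {..<m + n} \<and>
      (\<forall>a b. length a = m \<longrightarrow> holds M (nth (a @ b)) \<psi> = (\<forall>k\<in>J. onwall M k c (pad m c a) (pad n c b) = (k \<in> E)))"
    if "finite J" "J \<subseteq> K" for J
    using that
  proof (induction J rule: finite_induct)
    case empty
    show ?case by (intro exI[of _ "FNot FF"]) (simp add: in_lang_def)
  next
    case (insert k J)
    then obtain \<psi> where \<psi>: "in_lang oag \<psi>" "equational_fm \<psi>" "fv \<psi> \<subseteq> {..<m + n}"
      "\<forall>a b. length a = m \<longrightarrow> holds M (nth (a @ b)) \<psi> = (\<forall>k\<in>J. onwall M k c (pad m c a) (pad n c b) = (k \<in> E))"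
      by auto
    define \<theta> where "\<theta> = FConj (if k \<in> E then W k else FNot (W k)) \<psi>"
    have "in_lang oag \<theta>" "fv \<theta> \<subseteq> {..<m + n}" using \<psi> langW[of k] fvW[of k] insert.prems
      by (auto simp: \<theta>_def in_lang_def)
    moreover have "equational_fm \<theta>" using \<psi> by (simp add: \<theta>_def W_def)
    moreover have "\<forall>a b. length a = m \<longrightarrow> holds M (nth (a @ b)) \<theta> =
        (\<forall>k\<in>insert k J. onwall M k c (pad m c a) (pad n c b) = (k \<in> E))"
      using \<psi>(4) W by (simp add: \<theta>_def)
    ultimately show ?case by blast
  qed
  from this[OF finite_K subset_refl] show ?thesis
    unfolding eq_definable2_def exact_def by (elim exE conjE) (rule exI, intro conjI, assumption+, auto)
qed

end

section \<open>Special stable sets are stable\<close>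

definition balanced :: "(nat \<Rightarrow> nat \<Rightarrow> bool) \<Rightarrow> bool" where
  "balanced P \<longleftrightarrow> (\<forall>H. infinite H \<longrightarrow> (\<exists>G\<subseteq>H. infinite G \<and> (\<exists>v. \<forall>i\<in>G. \<forall>j\<in>G. i \<noteq> j \<longrightarrow> P i j = v)))"

lemma balancedD:
  assumes "balanced P" "infinite H"
  shows "\<exists>G v. G \<subseteq> H \<and> infinite G \<and> (\<forall>i\<in>G. \<forall>j\<in>G. i \<noteq> j \<longrightarrow> P i j = v)"
  using assms unfolding balanced_def by (elim allE[of _ H] impE) auto

lemma not_balanced_half_graph: "\<not> balanced (\<lambda>i j. i \<le> j)"
proof
  assume "balanced (\<lambda>i j. i \<le> j)"
  from balancedD[OF this infinite_UNIV_nat] obtain G :: "nat set" and v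
    where G: "infinite G" "\<forall>i\<in>G. \<forall>j\<in>G. i \<noteq> j \<longrightarrow> (i \<le> j) = v" by (elim exE conjE)
  obtain i where "i \<in> G" using G(1) infinite_imp_nonempty by blast
  moreover obtain j where "j \<in> G" "i < j" using G(1) infinite_nat_iff_unbounded by blast
  ultimately have "(i \<le> j) = v" "(j \<le> i) = v" using G(2) by auto
  then show False using \<open>i < j\<close> by auto
qed

lemma balanced_const: "balanced (\<lambda>i j. v)"
  unfolding balanced_def by blast

lemma balanced_not: "balanced P \<Longrightarrow> balanced (\<lambda>i j. \<not> P i j)"
  unfolding balanced_def by metis

lemma balanced_op:
  assumes "balanced P" "balanced Q"
  shows "balanced (\<lambda>i j. f (P i j) (Q i j))"
  unfolding balanced_def
proof (intro allI impI)
  fix H :: "nat set" assume "infinite H"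
  from balancedD[OF assms(1) this] obtain G v
    where G: "G \<subseteq> H" "infinite G" "\<forall>i\<in>G. \<forall>j\<in>G. i \<noteq> j \<longrightarrow> P i j = v" by (elim exE conjE)
  from balancedD[OF assms(2) G(2)] obtain G' v'
    where G': "G' \<subseteq> G" "infinite G'" "\<forall>i\<in>G'. \<forall>j\<in>G'. i \<noteq> j \<longrightarrow> Q i j = v'" by (elim exE conjE)
  have "\<forall>i\<in>G'. \<forall>j\<in>G'. i \<noteq> j \<longrightarrow> f (P i j) (Q i j) = f v v'"
  proof (intro ballI impI)
    fix i j assume ij: "i \<in> G'" "j \<in> G'" "i \<noteq> j"
    then have "P i j = v" "Q i j = v'" using G(3) G'(1,3) by (meson subsetD)+
    then show "f (P i j) (Q i j) = f v v'" by simp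
  qed
  moreover have "G' \<subseteq> H" using G G' by simp
  ultimately show "\<exists>G\<subseteq>H. infinite G \<and> (\<exists>v. \<forall>i\<in>G. \<forall>j\<in>G. i \<noteq> j \<longrightarrow> f (P i j) (Q i j) = v)"
    using G'(2) by (intro exI[of _ G'] exI[of _ "f v v'"] conjI)
qed

lemma balanced_unary: "balanced (\<lambda>i j. p i)" "balanced (\<lambda>i j. p j)"
proof -
  have *: "\<exists>G v. G \<subseteq> H \<and> infinite G \<and> (\<forall>i\<in>G. p i = v)" if "infinite H" for H
  proof (cases "infinite {i\<in>H. p i}")
    case True
    then show ?thesis by (intro exI[of _ "{i\<in>H. p i}"] exI[of _ True]) auto
  next
    case False
    moreover have "H = {i\<in>H. p i} \<union> {i\<in>H. \<not> p i}" by blast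
    ultimately have "infinite {i\<in>H. \<not> p i}" using that by (metis finite_Un)
    then show ?thesis by (intro exI[of _ "{i\<in>H. \<not> p i}"] exI[of _ False]) auto
  qed
  show "balanced (\<lambda>i j. p i)" unfolding balanced_def
  proof (intro allI impI)
    fix H :: "nat set" assume "infinite H"
    from *[OF this] obtain G v where "G \<subseteq> H" "infinite G" "\<forall>i\<in>G. p i = v" by (elim exE conjE)
    then show "\<exists>G\<subseteq>H. infinite G \<and> (\<exists>v. \<forall>i\<in>G. \<forall>j\<in>G. i \<noteq> j \<longrightarrow> p i = v)"
      by (intro exI[of _ G] exI[of _ v] conjI) auto
  qed
  show "balanced (\<lambda>i j. p j)" unfolding balanced_def
  proof (intro allI impI)
    fix H :: "nat set" assume "infinite H"
    from *[OF this] obtain G v where "G \<subseteq> H" "infinite G" "\<forall>i\<in>G. p i = v" by (elim exE conjE)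
    then show "\<exists>G\<subseteq>H. infinite G \<and> (\<exists>v. \<forall>i\<in>G. \<forall>j\<in>G. i \<noteq> j \<longrightarrow> p j = v)"
      by (intro exI[of _ G] exI[of _ v] conjI) auto
  qed
qed

text \<open>Ramsey's theorem makes \<open>P\<close> constant above the diagonal and constant below
  it. Three corners of a rectangle on one side of the diagonal then force a fourth corner on the
  other, so the two constants agree.\<close>

lemma balanced_rectangular:
  assumes rect: "\<And>i i' j j'. P i j \<Longrightarrow> P i j' \<Longrightarrow> P i' j \<Longrightarrow> P i' j'"
  shows "balanced P"
  unfolding balanced_def
proof (intro allI impI)
  fix H :: "nat set" assume "infinite H"
  \<comment> \<open>The four colours record the two truth values of \<open>P\<close> at a pair of
    indices, taken in both orders.\<close>
  define color where "color A = (if P (Min A) (Max A) then 1 else 0) + (if P (Max A) (Min A) then 2 else (0::nat))" for A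
  have "\<forall>x\<in>H. \<forall>y\<in>H. x \<noteq> y \<longrightarrow> color {x, y} < 4" by (auto simp: color_def)
  from Ramsey2[OF \<open>infinite H\<close> this] obtain G t where G: "G \<subseteq> H" "infinite G"
    and t: "\<forall>x\<in>G. \<forall>y\<in>G. x \<noteq> y \<longrightarrow> color {x, y} = t" by blast
  have pairs: "P i j = P i' j' \<and> P j i = P j' i'" if "i \<in> G" "j \<in> G" "i < j" "i' \<in> G" "j' \<in> G" "i' < j'" for i j i' j'
  proof -
    have "color {i, j} = color {i', j'}" using t that by (metis less_irrefl)
    then show ?thesis using that by (auto simp: color_def split: if_splits)
  qed
  define e where "e = enumerate G"
  have e: "e i \<in> G" "i < j \<Longrightarrow> e i < e j" for i j
    using G(2) by (auto simp: e_def enumerate_in_set enumerate_mono)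
  have up: "P (e i) (e j) = P (e 0) (e 1)" if "i < j" for i j using pairs[of "e i" "e j" "e 0" "e 1"] e that by auto
  have down: "P (e j) (e i) = P (e 1) (e 0)" if "i < j" for i j using pairs[of "e i" "e j" "e 0" "e 1"] e that by auto
  have "P (e 0) (e 1) = P (e 1) (e 0)"
  proof
    assume *: "P (e 0) (e 1)"
    \<comment> \<open>The corners \<open>(0, 3)\<close>, \<open>(0, 1)\<close> and
      \<open>(2, 3)\<close> lie above the diagonal, the fourth corner \<open>(2, 1)\<close> below
      it.\<close>
    have "P (e 2) (e 1)" using up[of 0 3] up[of 0 1] up[of 2 3] * by (intro rect[of "e 0" "e 3" "e 1" "e 2"]) auto
    then show "P (e 1) (e 0)" using down[of 1 2] by simp
  next
    assume *: "P (e 1) (e 0)"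
    have "P (e 1) (e 2)" using down[of 0 3] down[of 2 3] * by (intro rect[of "e 3" "e 0" "e 2" "e 1"]) auto
    then show "P (e 0) (e 1)" using up[of 1 2] by simp
  qed
  then have "P i j = P (e 0) (e 1)" if "i \<in> G" "j \<in> G" "i \<noteq> j" for i j
    using that pairs[of i j "e 0" "e 1"] pairs[of j i "e 0" "e 1"] e(1)[of 0] e(1)[of 1] e(2)[of 0 1]
    by (cases "i < j") auto
  then show "\<exists>G\<subseteq>H. infinite G \<and> (\<exists>v. \<forall>i\<in>G. \<forall>j\<in>G. i \<noteq> j \<longrightarrow> P i j = v)"
    using G by blast
qed

section \<open>Equations define rectangular relations\<close>

lemma rv_four_points: "(\<And>v. e1 v + e2 v = e3 v + e4 v) \<Longrightarrow> rv e1 t + rv e2 t = rv e3 t + rv e4 t"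
  by (induction t) (auto simp: algebra_simps)

definition eqn where
  "eqn S m n s t c x y \<longleftrightarrow> tv S (comb m n x y c) s = tv S (comb m n x y c) t"

text \<open>Over the reals, the values of a term at opposite corners of a rectangle have the same
  sum, so equality of two terms at three corners gives it at the fourth. Transfer spares the algebra
  in \<open>M\<close> and covers both languages.\<close>

lemma equation_rectangular:
  fixes M :: "'a struc"
  assumes M: "models_T oag M" and st: "pure_trm oag s" "pure_trm oag t"
    and xy: "eqn M m n s t c x y" "eqn M m n s t c x y'" "eqn M m n s t c x' y"
  shows "eqn M m n s t c x' y'"
proof -
  let ?e = "eqn M m n s t" and ?e' = "eqn real_struc m n s t"
  have fo_eqn: "fo oag M (\<lambda>B. ?e (B k) (B i) (B j)) (\<lambda>B. ?e' (B k) (B i) (B j))" for i j k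
    unfolding eqn_def comb_blocks by (intro fo_tv_eq st)
  have "fo oag M
    (\<lambda>B. ?e (B 0) (B 1) (B 3) \<and> ?e (B 0) (B 1) (B 4) \<and> ?e (B 0) (B 2) (B 3) \<longrightarrow> ?e (B 0) (B 2) (B 4))
    (\<lambda>B. ?e' (B 0) (B 1) (B 3) \<and> ?e' (B 0) (B 1) (B 4) \<and> ?e' (B 0) (B 2) (B 3) \<longrightarrow> ?e' (B 0) (B 2) (B 4))"
    by (intro fo_imp fo_conj fo_eqn)
  note transfer = fo_transfer[OF M this]
  have four: "rv (comb m n x y c) t + rv (comb m n x' y' c) t = rv (comb m n x y' c) t + rv (comb m n x' y c) t"
    for x y x' y' c t
    by (rule rv_four_points) (auto simp: comb_def)
  have "?e' c x' y'" if "?e' c x y" "?e' c x y'" "?e' c x' y" for x y x' y' c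
    using that four[of x y c s x' y'] four[of x y c t x' y'] unfolding eqn_def by linarith
  with transfer have "\<forall>B :: nat \<Rightarrow> nat \<Rightarrow> 'a.
      ?e (B 0) (B 1) (B 3) \<and> ?e (B 0) (B 1) (B 4) \<and> ?e (B 0) (B 2) (B 3) \<longrightarrow> ?e (B 0) (B 2) (B 4)" by blast
  from spec[OF this, of "\<lambda>b. if b = 0 then c else if b = 1 then x else if b = 2 then x' else if b = 3 then y else y'"]
  show ?thesis using xy by simp
qed

text \<open>Equations are the only base case of interest. Their parameters are turned into
  variables, so that rectangularity of pure equations applies with \<open>c\<close> held
  fixed.\<close>

lemma balanced_equational:
  fixes M :: "'a struc"
  assumes "models_T oag M" "in_lang oag \<chi>" "equational_fm \<chi>" "fv \<chi> \<subseteq> {..<m + n}"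
    and len: "\<And>i. length (a i) = m" "\<And>j. length (b j) = n"
  shows "balanced (\<lambda>i j. holds M (nth (a i @ b j)) \<chi>)"
  using assms(2-4)
proof (induction \<chi>)
  case FF
  show ?case by (simp add: balanced_const)
next
  case (Eq s t)
  have "finite (set_trm s \<union> set_trm t)" by (simp add: finite_set_trm)
  from enumerate_parameters[OF this] obtain g :: "'a \<Rightarrow> nat" and c
    where gc: "\<forall>x\<in>set_trm s \<union> set_trm t. c (2 * g x + 1) = x" by (elim exE)
  have tv: "tval M (nth (a i @ b j)) r = tv M (comb m n (nth (a i)) (nth (b j)) c) (dpt g r)"
    if "r = s \<or> r = t" for i j r
  proof -
    have "tval M (nth (a i @ b j)) r = tv M (interleave (nth (a i @ b j)) c) (dpt g r)"
      by (rule tv_dpt[symmetric]) (use gc that in auto)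
    also have "\<dots> = tv M (comb m n (nth (a i)) (nth (b j)) c) (dpt g r)"
    proof (rule tv_cong)
      fix v assume "v \<in> fvt (dpt g r)"
      then have "odd v \<or> v div 2 < m + n" using fvt_dpt[of v g r] Eq.prems(3) that by auto
      then show "interleave (nth (a i @ b j)) c v = comb m n (nth (a i)) (nth (b j)) c v"
        using comb_interleave[of v m n "a i" "b j" c] len by simp
    qed
    finally show ?thesis .
  qed
  have "pure_trm oag (dpt g s)" "pure_trm oag (dpt g t)"
    using Eq.prems(1) by (auto simp: in_lang_def intro: pure_dpt)
  note rect = equation_rectangular[OF assms(1) this, of m n]
  show ?case unfolding holds.simps tv[OF disjI1[OF refl]] tv[OF disjI2[OF refl]] eqn_def[symmetric]
    by (rule balanced_rectangular) (rule rect)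
next
  case (FNot \<chi>)
  then show ?case by (simp add: in_lang_def balanced_not)
next
  case (FConj \<chi> \<psi>)
  then have "balanced (\<lambda>i j. holds M (nth (a i @ b j)) \<chi>)" "balanced (\<lambda>i j. holds M (nth (a i @ b j)) \<psi>)"
    by (auto simp: in_lang_def)
  then show ?case using balanced_op[of _ _ "(\<and>)"] by simp
qed simp_all

lemma special_stable_balanced:
  assumes "models_T oag M" "special_stable oag M m n S"
    and len: "\<And>i. length (a i) = m" "\<And>j. length (b j) = n"
  shows "balanced (\<lambda>i j. (a i, b j) \<in> S)"
proof -
  obtain X Y Z where Z: "eq_definable2 oag M m n Z" and S: "S = Z \<inter> (X \<times> Y)"
    using assms(2) unfolding special_stable_def by blast
  obtain \<chi> where \<chi>: "in_lang oag \<chi>" "equational_fm \<chi>" "fv \<chi> \<subseteq> {..<m + n}"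
    "Z = {(a, b). length a = m \<and> length b = n \<and> holds M (nth (a @ b)) \<chi>}"
    using Z unfolding eq_definable2_def by blast
  have "balanced (\<lambda>i j. (a i, b j) \<in> Z)"
    using balanced_equational[OF assms(1) \<chi>(1-3) len] len by (simp add: \<chi>(4))
  from balanced_op[OF this balanced_op[OF balanced_unary(1)[of "\<lambda>i. a i \<in> X"]
        balanced_unary(2)[of "\<lambda>j. b j \<in> Y"], of "(\<and>)"], of "(\<and>)"]
  show ?thesis by (simp add: S)
qed

lemma union_special_stable:
  assumes "models_T oag M" "finite F" "\<And>S. S \<in> F \<Longrightarrow> special_stable oag M m n S"
  shows "stable_xy m n (\<Union>F)"
  unfolding stable_xy_def
proof
  assume "unstable m n (\<Union>F)"
  then obtain a b :: "nat \<Rightarrow> 'a list" where len: "\<And>i. length (a i) = m" "\<And>j. length (b j) = n"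
    and half: "\<And>i j. (a i, b j) \<in> \<Union>F \<longleftrightarrow> i \<le> j" unfolding unstable_def by blast
  have "balanced (\<lambda>i j. (a i, b j) \<in> \<Union>F)" using assms(2,3)
  proof (induction F rule: finite_induct)
    case empty
    show ?case by (simp add: balanced_const)
  next
    case (insert S F)
    have "balanced (\<lambda>i j. (a i, b j) \<in> S)"
      using assms(1) insert.prems[of S] len by (intro special_stable_balanced) auto
    moreover have "balanced (\<lambda>i j. (a i, b j) \<in> \<Union>F)" using insert.prems by (intro insert.IH) auto
    ultimately have "balanced (\<lambda>i j. (a i, b j) \<in> S \<or> (a i, b j) \<in> \<Union>F)"
      by (rule balanced_op[of _ _ "(\<or>)"])
    then show ?case by simp
  qed
  then show False using not_balanced_half_graph by (simp only: half)
qed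

section \<open>Decomposing stable sets\<close>

context separated
begin

text \<open>The existential part asks for a pair \<open>(x', y')\<close> in the relation that has
  the same common values and matches the patterns \<open>A\<close> and \<open>B\<close>. It mentions
  no \<open>y\<close>, yet by homogeneity it decides the relation for every \<open>y\<close> that
  completes the piece.\<close>

definition pieceX where
  "pieceX M E \<xi> \<eta> A B c = {a. length a = m \<and> cellX M \<xi> c (pad m c a) \<and>
    (\<forall>k\<in>K. belowX M E \<eta> c (pad m c a) k = (k \<in> A)) \<and>
    (\<exists>x' y'. cellX M \<xi> c x' \<and> cellY M \<eta> c y' \<and> exact M E c x' y' \<and> agree M E c (pad m c a) y' \<and>
      (\<forall>k\<in>K. belowX M E \<eta> c x' k = (k \<in> A)) \<and> (\<forall>k\<in>K. belowY M E \<xi> c y' k = (k \<in> B)) \<and> rel M c x' y')}"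

definition pieceY where
  "pieceY M E \<xi> \<eta> B c = {b. length b = n \<and> cellY M \<eta> c (pad n c b) \<and>
    (\<forall>k\<in>K. belowY M E \<xi> c (pad n c b) k = (k \<in> B))}"

definition pieceXY where
  "pieceXY M E c = {(a, b). length a = m \<and> length b = n \<and> exact M E c (pad m c a) (pad n c b)}"

lemma definable_pieceX:
  assumes "E \<subseteq> K"
  shows "definable oag M m (pieceX M E \<xi> \<eta> A B c)"
proof -
  have "fo oag M (\<lambda>B'. cellX M \<xi> (B' 0) (B' 1) \<and> (\<forall>k\<in>K. belowX M E \<eta> (B' 0) (B' 1) k = (k \<in> A)) \<and>
      (\<exists>x' y'. cellX M \<xi> (B' 0) x' \<and> cellY M \<eta> (B' 0) y' \<and> exact M E (B' 0) x' y' \<and> agree M E (B' 0) (B' 1) y' \<and>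
      (\<forall>k\<in>K. belowX M E \<eta> (B' 0) x' k = (k \<in> A)) \<and> (\<forall>k\<in>K. belowY M E \<xi> (B' 0) y' k = (k \<in> B)) \<and> rel M (B' 0) x' y'))
    (\<lambda>B'. cellX real_struc \<xi> (B' 0) (B' 1) \<and> (\<forall>k\<in>K. belowX real_struc E \<eta> (B' 0) (B' 1) k = (k \<in> A)) \<and>
      (\<exists>x' y'. cellX real_struc \<xi> (B' 0) x' \<and> cellY real_struc \<eta> (B' 0) y' \<and> exact real_struc E (B' 0) x' y' \<and>
       agree real_struc E (B' 0) (B' 1) y' \<and> (\<forall>k\<in>K. belowX real_struc E \<eta> (B' 0) x' k = (k \<in> A)) \<and>
       (\<forall>k\<in>K. belowY real_struc E \<xi> (B' 0) y' k = (k \<in> B)) \<and> rel real_struc (B' 0) x' y'))"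
    apply (intro fo_conj)
      apply (rule fo_cellX)
     apply (intro fo_ball fo_iff fo_const fo_belowX finite_K assms, assumption, simp)
    apply (rule fo_ex[where b = 2], rule fo_ex[where b = 3])
        apply (intro fo_conj fo_cellX fo_cellY fo_exact fo_agree fo_ball fo_iff fo_const fo_belowX fo_belowY
        fo_rel finite_K assms)
           apply simp_all
    done
  from definable_fo[OF this, of m c] show ?thesis by (simp add: pieceX_def)
qed

lemma definable_pieceY:
  assumes "E \<subseteq> K"
  shows "definable oag M n (pieceY M E \<xi> \<eta> B c)"
proof -
  have "fo oag M (\<lambda>B'. cellY M \<eta> (B' 0) (B' 1) \<and> (\<forall>k\<in>K. belowY M E \<xi> (B' 0) (B' 1) k = (k \<in> B)))
    (\<lambda>B'. cellY real_struc \<eta> (B' 0) (B' 1) \<and> (\<forall>k\<in>K. belowY real_struc E \<xi> (B' 0) (B' 1) k = (k \<in> B)))"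
    by (intro fo_conj fo_cellY fo_ball fo_iff fo_const fo_belowY finite_K assms) simp_all
  from definable_fo[OF this, of n c] show ?thesis by (simp add: pieceY_def)
qed

lemma special_stable_piece:
  assumes "models_T oag M" "E \<subseteq> K"
  shows "special_stable oag M m n (pieceXY M E c \<inter> (pieceX M E \<xi> \<eta> A B c \<times> pieceY M E \<xi> \<eta> B c))"
  unfolding special_stable_def
  using definable_pieceX[OF assms(2)] definable_pieceY[OF assms(2)] exact_definable[OF assms(1)]
  unfolding pieceXY_def by blast

lemma rel_pad: "rel M c (pad m c a) (pad n c b) = rel M c (nth a) (nth b)"
proof -
  have "comb m n (pad m c a) (pad n c b) c = comb m n (nth a) (nth b) c"
    by (rule comb_cong) (auto simp: pad_def)
  then show ?thesis by (simp add: rel_def)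
qed

text \<open>Each pair lies in the piece given by its own walls, cells and patterns, with itself as
  the witness. Conversely, homogeneity carries the relation from the witness of a piece to every
  pair in it.\<close>

lemma decomposition:
  assumes hom: "\<And>E \<xi> \<eta>. E \<subseteq> K \<Longrightarrow> homogeneous M E \<xi> \<eta> c"
  shows "{(a, b). length a = m \<and> length b = n \<and> rel M c (nth a) (nth b)} =
    \<Union> ((\<lambda>(E, \<xi>, \<eta>, A, B). pieceXY M E c \<inter> (pieceX M E \<xi> \<eta> A B c \<times> pieceY M E \<xi> \<eta> B c)) `
      (Pow K \<times> Pow PX \<times> Pow PY \<times> Pow K \<times> Pow K))" (is "?D = \<Union>(?f ` ?I)")
proof (intro set_eqI iffI)
  fix p assume "p \<in> ?D"
  then obtain a b where p: "p = (a, b)" and len: "length a = m" "length b = n" and r: "rel M c (pad m c a) (pad n c b)"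
    by (auto simp: rel_pad)
  let ?x = "pad m c a" and ?y = "pad n c b"
  define E where "E = {k\<in>K. onwall M k c ?x ?y}"
  define \<xi> where "\<xi> = {k\<in>PX. s_less M (xv M c ?x (fst k)) (xv M c ?x (snd k))}"
  define \<eta> where "\<eta> = {k\<in>PY. s_less M (yv M c ?y (fst k)) (yv M c ?y (snd k))}"
  define A where "A = {k\<in>K. belowX M E \<eta> c ?x k}"
  define B where "B = {k\<in>K. belowY M E \<xi> c ?y k}"
  have x: "cellX M \<xi> c ?x" "\<forall>k\<in>K. belowX M E \<eta> c ?x k = (k \<in> A)" by (auto simp: cellX_def \<xi>_def A_def)
  have y: "cellY M \<eta> c ?y" "\<forall>k\<in>K. belowY M E \<xi> c ?y k = (k \<in> B)" by (auto simp: cellY_def \<eta>_def B_def)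
  have xy: "exact M E c ?x ?y" "agree M E c ?x ?y" by (auto simp: exact_def agree_def E_def)
  have "a \<in> pieceX M E \<xi> \<eta> A B c" unfolding pieceX_def mem_Collect_eq
    by (intro conjI exI[of _ ?x] exI[of _ ?y] x y xy r len)
  moreover have "b \<in> pieceY M E \<xi> \<eta> B c" unfolding pieceY_def mem_Collect_eq by (intro conjI y len)
  moreover have "(a, b) \<in> pieceXY M E c" using xy len by (simp add: pieceXY_def)
  ultimately have "p \<in> ?f (E, \<xi>, \<eta>, A, B)" by (simp add: p)
  moreover have "(E, \<xi>, \<eta>, A, B) \<in> ?I" by (auto simp: E_def \<xi>_def \<eta>_def A_def B_def)
  ultimately show "p \<in> \<Union>(?f ` ?I)" by (intro UnionI[OF imageI])
next
  fix p assume "p \<in> \<Union>(?f ` ?I)"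
  then obtain E \<xi> \<eta> A B where E: "E \<subseteq> K"
    and p': "p \<in> pieceXY M E c \<inter> (pieceX M E \<xi> \<eta> A B c \<times> pieceY M E \<xi> \<eta> B c)" by auto
  then obtain a b where p: "p = (a, b)" "(a, b) \<in> pieceXY M E c" "a \<in> pieceX M E \<xi> \<eta> A B c" "b \<in> pieceY M E \<xi> \<eta> B c"
    by blast
  let ?x = "pad m c a" and ?y = "pad n c b"
  obtain x' y' where xy': "cellX M \<xi> c x'" "cellY M \<eta> c y'" "exact M E c x' y'" "agree M E c ?x y'"
    "\<forall>k\<in>K. belowX M E \<eta> c x' k = (k \<in> A)" "\<forall>k\<in>K. belowY M E \<xi> c y' k = (k \<in> B)" "rel M c x' y'"
    using p(3) unfolding pieceX_def by blast
  have x: "length a = m" "cellX M \<xi> c ?x" "\<forall>k\<in>K. belowX M E \<eta> c ?x k = (k \<in> A)"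
    using p(3) unfolding pieceX_def by blast+
  have y: "length b = n" "cellY M \<eta> c ?y" "\<forall>k\<in>K. belowY M E \<xi> c ?y k = (k \<in> B)"
    using p(4) unfolding pieceY_def by blast+
  have ex: "exact M E c ?x ?y" using p(2) by (simp add: pieceXY_def)
  have AB: "\<forall>k\<in>K. belowX M E \<eta> c ?x k = belowX M E \<eta> c x' k" "\<forall>k\<in>K. belowY M E \<xi> c ?y k = belowY M E \<xi> c y' k"
    using x y xy' by simp_all
  have "rel M c ?x ?y = rel M c x' y'"
    using hom[OF E, of \<xi> \<eta>, unfolded homogeneous_def, rule_format, of ?x x' ?y y'] x(2) y(2) xy'(1-4) ex AB by blast
  then show "p \<in> ?D" using xy'(7) p(1) x(1) y(1) by (simp add: rel_pad)
qed

text \<open>The parameters \<open>c\<close> occupy block 0, which is universally quantified in the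
  transferred sentence; so arbitrary parameters of \<open>M\<close> are covered although the reals
  know nothing of them.\<close>

lemma model_dichotomy:
  assumes "models_T oag M" determined "E \<subseteq> K"
  shows "dichotomy M E \<xi> \<eta> c"
proof -
  have "\<forall>B :: nat \<Rightarrow> nat \<Rightarrow> real. dichotomy real_struc E \<xi> \<eta> (B 0)"
    by (intro allI real_dichotomy[OF assms(2,3)])
  then have "\<forall>B :: nat \<Rightarrow> nat \<Rightarrow> _. dichotomy M E \<xi> \<eta> (B 0)"
    by (rule iffD2[OF fo_transfer[OF assms(1) fo_dichotomy[OF assms(3)]]])
  from spec[OF this, of "\<lambda>_. c"] show ?thesis .
qed

end

lemma definable2E:
  fixes M :: "'a struc"
  assumes "definable2 oag M m n D"
  obtains \<phi> c where "pure_fm oag \<phi>"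
    "D = {(a, b). length a = m \<and> length b = n \<and> sat M (comb m n (nth a) (nth b) c) \<phi>}"
proof -
  from assms obtain \<psi> where \<psi>: "in_lang oag \<psi>" "fv \<psi> \<subseteq> {..<m + n}"
    "(\<lambda>(a, b). a @ b) ` D = {as. length as = m + n \<and> holds M (nth as) \<psi>}"
    and D: "D \<subseteq> {(a, b). length a = m \<and> length b = n}"
    unfolding definable2_def definable_def by blast
  obtain g :: "'a \<Rightarrow> nat" and c where gc: "\<forall>x\<in>set_fm \<psi>. c (2 * g x + 1) = x"
    using enumerate_parameters[OF finite_set_fm[of \<psi>]] by (elim exE)
  have sat: "sat M (comb m n (nth a) (nth b) c) (dp g \<psi>) = holds M (nth (a @ b)) \<psi>" if "length a = m" for a b
  proof -
    have "sat M (comb m n (nth a) (nth b) c) (dp g \<psi>) = sat M (interleave (nth (a @ b)) c) (dp g \<psi>)"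
    proof (rule sat_cong)
      fix v assume "v \<in> fv (dp g \<psi>)"
      then have "odd v \<or> v div 2 < m + n" using fv_dp[of v g \<psi>] \<psi>(2) by auto
      then show "comb m n (nth a) (nth b) c v = interleave (nth (a @ b)) c v"
        using that by (rule comb_interleave)
    qed
    then show ?thesis using sat_dp[of \<psi> c g] gc by simp
  qed
  \<comment> \<open>Concatenation is injective once the length of the first list is fixed.\<close>
  have mem: "(a, b) \<in> D \<longleftrightarrow> a @ b \<in> (\<lambda>(a, b). a @ b) ` D" if "length a = m" for a b
  proof
    assume "(a, b) \<in> D"
    then show "a @ b \<in> (\<lambda>(a, b). a @ b) ` D" by (rule rev_image_eqI) simp
  next
    assume "a @ b \<in> (\<lambda>(a, b). a @ b) ` D"
    then obtain a' b' where "(a', b') \<in> D" "a @ b = a' @ b'" by auto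
    moreover from this have "length a' = m" using D by blast
    ultimately show "(a, b) \<in> D" using that by simp
  qed
  have "(a, b) \<in> D \<longleftrightarrow> length a = m \<and> length b = n \<and> sat M (comb m n (nth a) (nth b) c) (dp g \<psi>)" for a b
  proof (cases "length a = m")
    case True
    then have "(a, b) \<in> D \<longleftrightarrow> length (a @ b) = m + n \<and> holds M (nth (a @ b)) \<psi>"
      using mem[of a b] unfolding \<psi>(3) by simp
    then show ?thesis using sat[OF True, of b] True by simp
  next
    case False
    then show ?thesis using D by auto
  qed
  then have "D = {(a, b). length a = m \<and> length b = n \<and> sat M (comb m n (nth a) (nth b) c) (dp g \<psi>)}"
    by auto
  then show ?thesis by (rule that[OF pure_dp[OF \<psi>(1)]])
qed

text \<open>A witness for any wall in any cell would make \<open>D\<close> unstable. So the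
  dichotomy yields homogeneity for all \<open>E\<close>, \<open>\<xi>\<close> and
  \<open>\<eta>\<close> simultaneously, with the one fixed \<open>c\<close>.\<close>

lemma stable_decomposition:
  assumes M: "models_T oag M" and "definable2 oag M m n D" and "stable_xy m n D"
  shows "\<exists>F. finite F \<and> (\<forall>S\<in>F. special_stable oag M m n S) \<and> D = \<Union>F"
proof -
  obtain \<phi> c where \<phi>: "pure_fm oag \<phi>"
    and D: "D = {(a, b). length a = m \<and> length b = n \<and> sat M (comb m n (nth a) (nth b) c) \<phi>}"
    by (rule definable2E[OF assms(2)])
  obtain K PX PY where sep: "separated oag K PX PY \<phi>" and det: "separated.determined m n K PX PY \<phi>"
    by (rule separable[OF \<phi>])
  interpret separated oag m n K PX PY \<phi> by (rule sep)
  have D': "D = {(a, b). length a = m \<and> length b = n \<and> rel M c (nth a) (nth b)}" by (simp add: D rel_def)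
  have "\<not> wit M E \<xi> \<eta> k b c" for E \<xi> \<eta> k b
    using wit_unstable[OF M, of E \<xi> \<eta> k b c D] assms(3) by (auto simp: D' stable_xy_def)
  then have hom: "homogeneous M E \<xi> \<eta> c" if "E \<subseteq> K" for E \<xi> \<eta>
    using model_dichotomy[OF M det that, of \<xi> \<eta> c] by (simp add: dichotomy_def)
  let ?f = "\<lambda>(E, \<xi>, \<eta>, A, B). pieceXY M E c \<inter> (pieceX M E \<xi> \<eta> A B c \<times> pieceY M E \<xi> \<eta> B c)"
  let ?I = "Pow K \<times> Pow PX \<times> Pow PY \<times> Pow K \<times> Pow K"
  have "finite (?f ` ?I)" using finite_K finite_PX finite_PY by simp
  moreover have "\<forall>S\<in>?f ` ?I. special_stable oag M m n S" using special_stable_piece[OF M] by auto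
  moreover have "D = \<Union>(?f ` ?I)" unfolding D' by (rule decomposition[OF hom])
  ultimately show ?thesis by blast
qed

theorem theorem4p1:
  fixes oag :: bool and M :: "'a struc" and m n :: nat
    and D :: "('a list \<times> 'a list) set"
  assumes "models_T oag M"
    and "definable2 oag M m n D"
  shows "stable_xy m n D \<longleftrightarrow>
    (\<exists>F. finite F \<and> (\<forall>S\<in>F. special_stable oag M m n S) \<and> D = \<Union>F)"
proof
  assume "stable_xy m n D"
  then show "\<exists>F. finite F \<and> (\<forall>S\<in>F. special_stable oag M m n S) \<and> D = \<Union>F"
    by (rule stable_decomposition[OF assms])
next
  assume "\<exists>F. finite F \<and> (\<forall>S\<in>F. special_stable oag M m n S) \<and> D = \<Union>F"
  then obtain F where "finite F" "\<forall>S\<in>F. special_stable oag M m n S" "D = \<Union>F" by (elim exE conjE)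
  then show "stable_xy m n D" using union_special_stable[OF assms(1)] by simp
qed

end
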